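(* Let $W$ be a point process on the open set $\mathcal{X}\subset\mathbb{R}$ with probability density function $p_X$ with respect to the distribution of a unit rate Poisson process on $\mathcal{X}$ marked independently with mark distribution $\nu$ (defined in the context). Write $X$ for the ground process of locations in $\mathcal{X}$ and let $$U=\bigcup_{(t,I)\in W}\{(t,0)+I\}\subset\mathbb{R}\times\mathbb{R}^+ .$$ Let $\mathbf{u}$ be a realisation of $U$ that consists of an atomic part $\{(a_1,0),\dots,(a_m,0)\}$, $m\in\mathbb{N}_0$, and a non-atomic part $\{(a_{m+1},l_{m+1}),\dots,(a_n,l_n)\}$, $n\ge m$ (with $l_i>0$ for $i=m+1,\dots,n$). Then the posterior distribution of $X$ given $U=\mathbf{u}$ satisfies, for every $A$ in the Borel $\sigma$-algebra of the weak topology on $\mathcal{N}_{\mathcal{X}}$, $$\mathbb{P}(X\in A\mid U=\mathbf{u})=c(\mathbf{u})\int_{\mathcal{X}^{n-m}}p_X(\{a_1,\dots,a_m,x_1,\dots,x_{n-m}\})\,\mathbf{1}_A(\{a_1,\dots,a_m,x_1,\dots,x_{n-m}\})\left(\sum_{\substack{D_1,\dots,D_{n-m}\\ \cup_i\{D_i\}=\{1,\dots,n-m\}}}\ \prod_{i=1}^{n-m}\mathbf{1}\{x_{D_i}\in[a_{m+i},a_{m+i}+l_{m+i}]\}\right)\prod_{i=1}^{n-m}dx_i,$$ provided that $c(\mathbf{u})^{-1}$ defined by $$\int_{\mathcal{X}^{n-m}}p_X(\{a_1,\dots,a_m,x_1,\dots,x_{n-m}\})\left(\sum_{\substack{D_1,\dots,D_{n-m}\\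 \cup_i\{D_i\}=\{1,\dots,n-m\}}}\ \prod_{i=1}^{n-m}\mathbf{1}\{x_{D_i}\in[a_{m+i},a_{m+i}+l_{m+i}]\}\right)\prod_{i=1}^{n-m}dx_i$$ exists in $(0,\infty)$.
   Context: $\mathbb{R}^+=[0,\infty)$; $\mathbf{1}$ denotes an indicator function and $\ell$ Lebesgue measure. Mark distribution $\nu$: let $(Y_i,Z_i)$, $i\in\mathbb{N}$, be independent and identically distributed random vectors with a joint probability density function on $(\mathbb{R}^+)^2$, and put $T_i=Y_i+Z_i$, with $0<\mathbb{E}T_1<\infty$. Let $f_Y$ be the probability density function of $Y_1$. Then $\nu$ is the probability distribution on $\mathbb{R}\times\mathbb{R}^+$ that is the mixture of an atom at $(0,0)$, with weight $\mathbb{E}Z_1/\mathbb{E}T_1$, and an absolutely continuous component, with weight $\mathbb{E}Y_1/\mathbb{E}T_1$, that has probability density function $f_Y(l)/\mathbb{E}Y_1$ on $\{(a,l)\in\mathbb{R}\times\mathbb{R}^+: a\le 0\le a+l\}$ (and zero elsewhere). Point processes: $\mathcal{N}_{\mathcal{X}}$ is the set of finite subsets $\{t_1,\dots,t_n\}\subset\mathcal{X}$, $n\in\mathbb{N}_0$, with the Borel $\sigma$-algebra of the weak topology; $\mathcal{N}_{\mathbb{R}\times\mathbb{R}^+}$ is defined likewise. Processes are finite; in particular $\ell(\mathcal{X})<\infty$. The ground process $X$ takes values in $\mathcal{N}_{\mathcal{X}}$ and has density $p_X:\mathcal{N}_{\mathcal{X}}\to[0,\infty)$ with respect to the distribution of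 the unit rate Poisson process on $\mathcal{X}$, i.e. for measurable $A$, $$\mathbb{P}(X\in A)=\sum_{k=0}^\infty\frac{e^{-\ell(\mathcal{X})}}{k!}\int_{\mathcal{X}^k}\mathbf{1}_A(\{x_1,\dots,x_k\})\,p_X(\{x_1,\dots,x_k\})\,dx_1\cdots dx_k .$$ $W$ is obtained from $X$ by attaching to the points of $X$ independent marks with distribution $\nu$; its realisations are finite sets $\{(t_1,I_1),\dots,(t_n,I_n)\}\subset\mathcal{X}\times(\mathbb{R}\times\mathbb{R}^+)$. A pair $(a,l)\in\mathbb{R}\times\mathbb{R}^+$ parametrises the interval $[a,a+l]$; for $I=(a,l)$, $(t,0)+I=(t+a,l)$. The sums over $D_1,\dots,D_{n-m}$ run over all ordered tuples with $\{D_1,\dots,D_{n-m}\}=\{1,\dots,n-m\}$, i.e. over all permutations (for $n=m$ the sum and the empty product equal $1$ and no integration is carried out). The posterior distribution of $X$ given $U$ is the conditional distribution: the claim is that the displayed expression defines a version of $\mathbb{P}(X\in A\mid U)$, i.e. $\mathbb{E}[\mathbf{1}_F(U)\,\mathbb{P}(X\in A\mid U)]=\mathbb{E}[\mathbf{1}_F(U)\mathbf{1}_A(X)]$ for every $A$ in the Borel $\sigma$-algebra of $\mathcal{N}_{\mathcal{X}}$ and every $F$ in the Borel $\sigma$-algebra of $\mathcal{N}_{\mathbb{R}\times\mathbb{R}^+}$. *)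

theory Defs
  imports "HOL-Probability.Probability" "HOL-Combinatorics.Permutations"
begin

definition configs :: "'a set \<Rightarrow> 'a set set" where
  "configs S = {\<phi>. finite \<phi> \<and> \<phi> \<subseteq> S}"

text \<open>The weak topology: a configuration is identified with its counting measure and tested
  against the bounded continuous functions on the state space.\<close>

definition weak_topology :: "'a::topological_space set \<Rightarrow> 'a set topology" where
  "weak_topology S = topology_generated_by
     {{\<phi> \<in> configs S. (\<Sum>x\<in>\<phi>. f x) \<in> V} | (f :: 'a \<Rightarrow> real) V.
        continuous_on S f \<and> bounded (f ` S) \<and> open V}"

definition weak_borel :: "'a::topological_space set \<Rightarrow> 'a set measure" where
  "weak_borel S = sigma (configs S) {G. openin (weak_topology S) G}"

text \<open>The pair \<open>(a, l)\<close> parametrises the interval \<open>[a, a + l]\<close>.\<close>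

definition marks :: "(real \<times> real) set" where
  "marks = UNIV \<times> {0..}"

definition mark_law ::
    "'r measure \<Rightarrow> ('r \<Rightarrow> real) \<Rightarrow> ('r \<Rightarrow> real) \<Rightarrow> (real \<Rightarrow> ennreal) \<Rightarrow> (real \<times> real) measure" where
  "mark_law R Y Z fY =
     (let EY = \<integral>\<omega>. Y \<omega> \<partial>R; EZ = \<integral>\<omega>. Z \<omega> \<partial>R; ET = \<integral>\<omega>. Y \<omega> + Z \<omega> \<partial>R in
      measure_of marks (sets (restrict_space borel marks))
        (\<lambda>B. ennreal (EZ / ET) * indicator B (0, 0)
           + ennreal (EY / ET) *
             (\<integral>\<^sup>+(a, l). fY l / ennreal EY * indicator {(a, l). a \<le> 0 \<and> 0 \<le> a + l} (a, l)
                * indicator B (a, l) \<partial>lborel)))"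

text \<open>Distribution of the unit rate Poisson process on \<open>S\<close> with independent marks of law \<open>\<nu>\<close>:
  given the number \<open>k\<close> of points, the pairs (location, mark) are integrated with respect to
  the \<open>k\<close>-fold product of \<open>dx \<nu>(dI)\<close>.\<close>

definition marked_poisson ::
    "real set \<Rightarrow> (real \<times> real) measure \<Rightarrow> (real \<times> real \<times> real) set measure" where
  "marked_poisson S \<nu> =
     measure_of (configs (S \<times> marks)) (sets (weak_borel (S \<times> marks)))
       (\<lambda>B. \<Sum>k. ennreal (exp (- measure lborel S) / fact k) *
          (\<integral>\<^sup>+w. indicator B (w ` {1..k}) \<partial>(\<Pi>\<^sub>M i\<in>{1..k}. restrict_space lborel S \<Otimes>\<^sub>M \<nu>)))"

definition ground :: "(real \<times> real \<times> real) set \<Rightarrow> real set" where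
  "ground w = fst ` w"

definition shifted :: "(real \<times> real \<times> real) set \<Rightarrow> (real \<times> real) set" where
  "shifted w = (\<Union>(t, I)\<in>w. {(t, 0) + I})"

text \<open>\<open>(a i, l i)\<close>, \<open>1 \<le> i \<le> n\<close>, enumerates \<open>u\<close> without repetition, the \<open>m\<close> atoms first. An
  atom is an exactly observed point of the ground process and hence lies in \<open>S\<close>.\<close>

definition enumerates ::
    "real set \<Rightarrow> (real \<times> real) set \<Rightarrow> nat \<Rightarrow> nat \<Rightarrow> (nat \<Rightarrow> real) \<Rightarrow> (nat \<Rightarrow> real) \<Rightarrow> bool" where
  "enumerates S u m n a l \<longleftrightarrow>
     m \<le> n \<and> u = (\<lambda>i. (a i, l i)) ` {1..n} \<and> inj_on (\<lambda>i. (a i, l i)) {1..n} \<and>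
     (\<forall>i\<in>{1..m}. a i \<in> S \<and> l i = 0) \<and> (\<forall>i\<in>{m+1..n}. 0 < l i)"

definition matchings ::
    "nat \<Rightarrow> nat \<Rightarrow> (nat \<Rightarrow> real) \<Rightarrow> (nat \<Rightarrow> real) \<Rightarrow> (nat \<Rightarrow> real) \<Rightarrow> ennreal" where
  "matchings m n a l x =
     (\<Sum>D | D permutes {1..n-m}. \<Prod>i=1..n-m. indicator {a (m+i)..a (m+i) + l (m+i)} (x (D i)))"

definition c_inv ::
    "real set \<Rightarrow> (real set \<Rightarrow> real) \<Rightarrow> nat \<Rightarrow> nat \<Rightarrow> (nat \<Rightarrow> real) \<Rightarrow> (nat \<Rightarrow> real) \<Rightarrow> ennreal" where
  "c_inv S p m n a l =
     (\<integral>\<^sup>+x. ennreal (p (a ` {1..m} \<union> x ` {1..n-m})) * matchings m n a l x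
        \<partial>(\<Pi>\<^sub>M i\<in>{1..n-m}. restrict_space lborel S))"

definition posterior ::
    "real set \<Rightarrow> (real set \<Rightarrow> real) \<Rightarrow> nat \<Rightarrow> nat \<Rightarrow> (nat \<Rightarrow> real) \<Rightarrow> (nat \<Rightarrow> real) \<Rightarrow>
     real set set \<Rightarrow> ennreal" where
  "posterior S p m n a l A =
     inverse (c_inv S p m n a l) *
     (\<integral>\<^sup>+x. ennreal (p (a ` {1..m} \<union> x ` {1..n-m})) * indicator A (a ` {1..m} \<union> x ` {1..n-m})
          * matchings m n a l x
        \<partial>(\<Pi>\<^sub>M i\<in>{1..n-m}. restrict_space lborel S))"

end

theory Submission
  imports Defs
begin

text \<open>Write a marked Poisson point as \<open>(t, (a, l))\<close> and substitute \<open>b = a + t\<close>. The law of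
  \<open>(t, (a, l))\<close> then factorises into a measure for the observation \<open>(b, l)\<close> and, given the
  observation, the measure \<open>1{t \<in> [b, b + l]} dt\<close> (or a point mass at \<open>b\<close> if \<open>l = 0\<close>) for the
  location. Taking products, the joint law of \<open>U\<close> and \<open>X\<close> factorises in the same way, with \<open>p\<close>
  entering as a density; normalising the conditional part gives the posterior. Each of the
  \<open>(n - m)!\<close> matchings contributes the same integral, so the sum cancels in the quotient.\<close>

section \<open>Measurability on spaces of configurations\<close>

text \<open>The obstacle is that densities and enumerations live on tuples, while the claim is about
  sets. Functions of a configuration must be measurable for the weak topology although every
  enumeration of it is an arbitrary choice, so measurability is transferred between tuples and sets
  in both directions, with ties allowed in one direction and excluded in the other. The marks mix
  dimensions: an atom fixes its location exactly, an interval leaves a one-dimensional location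
  free. Giving every point the same number of real coordinates lets one product formula treat all
  numbers of atoms at once. That the normalising constant almost surely lies in (0, \<infinity>) is
  derived: it is finite because the joint law has total mass one, and positive because observations
  with vanishing constant carry no mass. Distinctness of the observed pairs, on which the
  identification of tuples with sets rests, holds almost everywhere because their first coordinate
  is governed by Lebesgue measure.\<close>

lemma openin_weak_topology_subset:
  assumes "openin (weak_topology X) G" shows "G \<subseteq> configs X"
proof -
  have "topspace (weak_topology X) \<subseteq> configs X"
    unfolding weak_topology_def topology_generated_by_topspace by auto
  then show ?thesis using openin_subset[OF assms] by blast
qed

lemma space_weak_borel [simp]: "space (weak_borel X) = configs X"
  using openin_weak_topology_subset unfolding weak_borel_def by (intro space_measure_of) blast

lemma openin_weak_borel:
  assumes "openin (weak_topology X) G" shows "G \<in> sets (weak_borel X)"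
  unfolding weak_borel_def using assms openin_weak_topology_subset
  by (subst sets_measure_of) auto

lemma measurable_weak_borelI:
  assumes "\<And>x. x \<in> space N \<Longrightarrow> f x \<in> configs X"
    and "\<And>G. openin (weak_topology X) G \<Longrightarrow> f -` G \<inter> space N \<in> sets N"
  shows "f \<in> measurable N (weak_borel X)"
proof (rule measurable_sigma_sets)
  show "sets (weak_borel X) = sigma_sets (configs X) {G. openin (weak_topology X) G}"
    using openin_weak_topology_subset unfolding weak_borel_def by (intro sets_measure_of) blast
  show "{G. openin (weak_topology X) G} \<subseteq> Pow (configs X)"
    using openin_weak_topology_subset by blast
qed (use assms in auto)

lemma measurable_config_sum:
  fixes f :: "'a::topological_space \<Rightarrow> real"
  assumes "continuous_on X f" "bounded (f ` X)"
  shows "(\<lambda>\<phi>. \<Sum>x\<in>\<phi>. f x) \<in> borel_measurable (weak_borel X)"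
proof (rule borel_measurableI)
  fix V :: "real set" assume V: "open V"
  have "openin (weak_topology X) {\<phi> \<in> configs X. (\<Sum>x\<in>\<phi>. f x) \<in> V}"
    unfolding weak_topology_def using assms V by (intro topology_generated_by_Basis) auto
  then have "{\<phi> \<in> configs X. (\<Sum>x\<in>\<phi>. f x) \<in> V} \<in> sets (weak_borel X)"
    by (rule openin_weak_borel)
  also have "{\<phi> \<in> configs X. (\<Sum>x\<in>\<phi>. f x) \<in> V}
      = (\<lambda>\<phi>. \<Sum>x\<in>\<phi>. f x) -` V \<inter> space (weak_borel X)"
    by auto
  finally show "(\<lambda>\<phi>. \<Sum>x\<in>\<phi>. f x) -` V \<inter> space (weak_borel X) \<in> sets (weak_borel X)" .
qed

text \<open>The weak topology tests continuous functions only, so the number of points in an open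
  set has to be reached by limits; truncated multiples of the distance to the complement serve for
  this.\<close>

lemma open_indicator_limit:
  fixes B :: "'a::metric_space set"
  assumes "open B"
  obtains f :: "nat \<Rightarrow> 'a \<Rightarrow> real" where
    "\<And>j. continuous_on UNIV (f j)" "\<And>j. bounded (range (f j))"
    "\<And>x. (\<lambda>j. f j x) \<longlonglongrightarrow> indicator B x"
proof (cases "B = UNIV")
  case True
  \<comment> \<open>\<open>infdist\<close> to the empty set is 0 by convention, so the distance
    formula would give the constant 0 here.\<close>
  show ?thesis by (rule that[of "\<lambda>_ _. 1"]) (auto simp: True)
next
  case False
  define f where "f j x = min 1 (real j * infdist x (- B))" for j x
  have lim: "(\<lambda>j. f j x) \<longlonglongrightarrow> indicator B x" for x
  proof (cases "x \<in> B")
    case True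
    have "infdist x (- B) > 0"
      using True assms False by (intro infdist_pos_not_in_closed) (auto simp: closed_Compl)
    then have "\<forall>\<^sub>F j in sequentially. real j * infdist x (- B) \<ge> 1"
      by real_asymp
    then have "\<forall>\<^sub>F j in sequentially. f j x = 1"
      by eventually_elim (auto simp: f_def)
    then show ?thesis using True by (simp add: tendsto_eventually)
  qed (simp add: f_def)
  have "bounded (range (f j))" for j
    by (rule boundedI[of _ 1]) (auto simp: f_def infdist_nonneg)
  moreover have "continuous_on UNIV (f j)" for j
    unfolding f_def by (intro continuous_intros)
  ultimately show ?thesis using lim that by blast
qed

lemma measurable_config_card [measurable]:
  fixes B :: "'a::metric_space set"
  assumes B: "open B"
  shows "(\<lambda>\<phi>. card (\<phi> \<inter> B)) \<in> measurable (weak_borel X) (count_space UNIV)"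
proof -
  obtain f :: "nat \<Rightarrow> 'a \<Rightarrow> real" where f: "\<And>j. continuous_on UNIV (f j)" "\<And>j. bounded (range (f j))"
    "\<And>x. (\<lambda>j. f j x) \<longlonglongrightarrow> indicator B x"
    using open_indicator_limit[OF B] by blast
  have "(\<lambda>\<phi>. real (card (\<phi> \<inter> B))) \<in> borel_measurable (weak_borel X)"
  proof (rule borel_measurable_LIMSEQ_real)
    fix \<phi> assume "\<phi> \<in> space (weak_borel X)"
    then have "real (card (\<phi> \<inter> B)) = (\<Sum>x\<in>\<phi>. indicator B x)"
      by (simp add: configs_def indicator_def Int_def flip: sum.inter_filter)
    moreover have "(\<lambda>j. \<Sum>x\<in>\<phi>. f j x) \<longlonglongrightarrow> (\<Sum>x\<in>\<phi>. indicator B x)"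
      by (intro tendsto_sum f)
    ultimately show "(\<lambda>j. \<Sum>x\<in>\<phi>. f j x) \<longlonglongrightarrow> real (card (\<phi> \<inter> B))" by simp
  next
    fix j
    show "(\<lambda>\<phi>. \<Sum>x\<in>\<phi>. f j x) \<in> borel_measurable (weak_borel X)"
      by (rule measurable_config_sum)
         (use f in \<open>auto intro: continuous_on_subset bounded_subset[of "range (f j)"]\<close>)
  qed
  then have *: "{\<phi>\<in>space (weak_borel X). real (card (\<phi> \<inter> B)) = real k} \<in> sets (weak_borel X)" for k
    by measurable
  show ?thesis
    by (rule measurable_count_space_eq2_countable[THEN iffD2])
       (use * in \<open>auto simp: vimage_def Int_def conj_commute\<close>)
qed

text \<open>On the set where the indices in \<open>J\<close> carry pairwise distinct values and these exhaust the
  image, the image is a continuous function of the tuple; ties are the only discontinuities.\<close>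

lemma measurable_image_config:
  fixes f :: "'i::countable \<Rightarrow> 'b \<Rightarrow> 'a::{second_countable_topology, metric_space}"
  assumes I: "finite I"
    and f [measurable]: "\<And>i. i \<in> I \<Longrightarrow> f i \<in> borel_measurable N"
    and X: "\<And>i x. i \<in> I \<Longrightarrow> x \<in> space N \<Longrightarrow> f i x \<in> X"
  shows "(\<lambda>x. (\<lambda>i. f i x) ` I) \<in> measurable N (weak_borel X)"
proof (rule measurable_weak_borelI)
  show "(\<lambda>i. f i x) ` I \<in> configs X" if "x \<in> space N" for x
    using that I X by (auto simp: configs_def)
next
  fix G assume G: "openin (weak_topology X) G"
  \<comment> \<open>Off \<open>I\<close> the tuple is filled with a constant, so that it lives in
    the full function space, where product and Borel sigma-algebra agree for a countable index
    type.\<close>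
  define F where "F x i = (if i \<in> I then f i x else undefined)" for x i
  have F: "F \<in> borel_measurable N"
  proof -
    have "(\<lambda>x. \<lambda>i\<in>UNIV. F x i) \<in> measurable N (PiM UNIV (\<lambda>_. borel))"
    proof (rule measurable_restrict)
      show "(\<lambda>x. F x i) \<in> borel_measurable N" for i
        using f[of i] by (cases "i \<in> I") (simp_all add: F_def)
    qed
    then have "F \<in> measurable N (PiM UNIV (\<lambda>_. borel))"
      by (simp add: restrict_def)
    then show ?thesis by (simp cong: measurable_cong_sets[OF refl sets_PiM_equal_borel])
  qed
  \<comment> \<open>Injectivity turns a sum over the image into a sum over the indices
    \<open>J\<close>, which depends continuously on the tuple.\<close>
  define D where "D J = {w. inj_on w J \<and> w ` J \<subseteq> X}" for J :: "'i set"
  have opn: "\<exists>O'. open O' \<and> {w \<in> D J. w ` J \<in> G} = O' \<inter> D J" if J: "J \<subseteq> I" for J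
  proof -
    have fin: "finite J" using I J finite_subset by blast
    have "continuous_map (top_of_set (D J)) (weak_topology X) (\<lambda>w. w ` J)"
      unfolding weak_topology_def
    proof (rule continuous_on_generated_topo)
      fix U assume "U \<in> {{\<phi> \<in> configs X. (\<Sum>x\<in>\<phi>. g x) \<in> V} | (g :: 'a \<Rightarrow> real) V.
        continuous_on X g \<and> bounded (g ` X) \<and> open V}"
      then obtain g :: "'a \<Rightarrow> real" and V where U: "U = {\<phi> \<in> configs X. (\<Sum>x\<in>\<phi>. g x) \<in> V}"
        and g: "continuous_on X g" and V: "open V" by blast
      have eq: "(\<lambda>w. w ` J) -` U \<inter> D J = (\<lambda>w. \<Sum>i\<in>J. g (w i)) -` V \<inter> D J"
        using fin by (auto simp: U D_def configs_def sum.reindex)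
      have "continuous_on (D J) (\<lambda>w. \<Sum>i\<in>J. g (w i))"
        by (intro continuous_on_sum continuous_on_compose2[OF g] continuous_on_subset[OF continuous_on_product_coordinates])
           (auto simp: D_def)
      then have "openin (top_of_set (D J)) (D J \<inter> (\<lambda>w. \<Sum>i\<in>J. g (w i)) -` V)"
        using V by (rule continuous_openin_preimage_gen)
      then show "openin (top_of_set (D J)) ((\<lambda>w. w ` J) -` U \<inter> topspace (top_of_set (D J)))"
        using eq by (simp add: Int_commute)
    next
      show "(\<lambda>w. w ` J) ` topspace (top_of_set (D J)) \<subseteq> \<Union> {{\<phi> \<in> configs X. (\<Sum>x\<in>\<phi>. g x) \<in> V} |
        (g :: 'a \<Rightarrow> real) V. continuous_on X g \<and> bounded (g ` X) \<and> open V}"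
      proof clarify
        fix w assume "w \<in> topspace (top_of_set (D J))"
        then have "w ` J \<in> configs X" using fin by (auto simp: D_def configs_def)
        moreover have "configs X \<in> {{\<phi> \<in> configs X. (\<Sum>x\<in>\<phi>. g x) \<in> V} |
          (g :: 'a \<Rightarrow> real) V. continuous_on X g \<and> bounded (g ` X) \<and> open V}"
          by (intro CollectI exI[of _ "\<lambda>_. 0"] exI[of _ UNIV]) (auto simp: image_constant_conv)
        ultimately show "w ` J \<in> \<Union> {{\<phi> \<in> configs X. (\<Sum>x\<in>\<phi>. g x) \<in> V} |
        (g :: 'a \<Rightarrow> real) V. continuous_on X g \<and> bounded (g ` X) \<and> open V}" by blast
      qed
    qed
    then have "openin (top_of_set (D J)) {w \<in> topspace (top_of_set (D J)). w ` J \<in> G}"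
      using G by (rule openin_continuous_map_preimage)
    then show ?thesis by (auto simp: openin_open)
  qed
  have eq_meas: "{x \<in> space N. dist (f i x) (f j x) = 0} \<in> sets N" if "i \<in> I" "j \<in> I" for i j
  proof -
    have [measurable]: "f i \<in> borel_measurable N" "f j \<in> borel_measurable N"
      using f that by auto
    show ?thesis by measurable
  qed
  have inj_meas: "{x \<in> space N. inj_on (F x) J} \<in> sets N" if J: "J \<subseteq> I" for J
  proof -
    have "finite J" using I J finite_subset by blast
    have "{x \<in> space N. inj_on (F x) J}
        = {x \<in> space N. \<forall>i\<in>J. \<forall>j\<in>J. dist (f i x) (f j x) = 0 \<longrightarrow> i = j}"
      using J by (auto simp: inj_on_def F_def)
    also have "\<dots> \<in> sets N"
      using \<open>finite J\<close> J
      by (intro sets.sets_Collect_finite_All sets.sets_Collect_imp sets.sets_Collect_const eq_meas) auto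
    finally show ?thesis .
  qed
  have im_meas: "{x \<in> space N. F x ` J = F x ` I} \<in> sets N" if J: "J \<subseteq> I" for J
  proof -
    have "finite J" using I J finite_subset by blast
    have "{x \<in> space N. F x ` J = F x ` I}
        = {x \<in> space N. \<forall>i\<in>I. \<exists>j\<in>J. dist (f i x) (f j x) = 0}"
      using J by (auto simp: F_def image_iff subset_eq)
    also have "\<dots> \<in> sets N"
      using \<open>finite J\<close> I J by (intro sets.sets_Collect_finite_All sets.sets_Collect_finite_Ex eq_meas) auto
    finally show ?thesis .
  qed
  have FI: "(\<lambda>i. f i x) ` I = F x ` I" for x by (auto simp: F_def)
  \<comment> \<open>Continuity only yields sets open relative to \<open>D J\<close>; intersecting
    with the measurable event of injectivity repairs this. The preimage of \<open>G\<close> is the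
    union of these pieces over the finitely many \<open>J\<close>.\<close>
  define P where "P J = {x \<in> space N. inj_on (F x) J} \<inter> {x \<in> space N. F x ` J = F x ` I} \<inter>
      {x \<in> space N. F x ` J \<in> G}" for J
  have "P J \<in> sets N" if J: "J \<subseteq> I" for J
  proof -
    obtain O' where O': "open O'" "{w \<in> D J. w ` J \<in> G} = O' \<inter> D J"
      using opn[OF J] by blast
    have inD: "F x \<in> D J" if "x \<in> space N" "inj_on (F x) J" for x
      using that J X by (auto simp: D_def F_def)
    have "P J = {x \<in> space N. inj_on (F x) J} \<inter> {x \<in> space N. F x ` J = F x ` I} \<inter> (F -` O' \<inter> space N)"
      using O'(2) inD unfolding P_def set_eq_iff by blast
    then show ?thesis
      using inj_meas[OF J] im_meas[OF J] measurable_sets[OF F borel_open[OF O'(1)]] by auto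
  qed
  then have "(\<Union>J\<in>Pow I. P J) \<in> sets N"
    using I by (intro sets.finite_UN) auto
  also have "(\<Union>J\<in>Pow I. P J) = (\<lambda>x. (\<lambda>i. f i x) ` I) -` G \<inter> space N"
  proof safe
    fix x assume x: "x \<in> space N" "(\<lambda>i. f i x) ` I \<in> G"
    \<comment> \<open>\<open>J\<close> keeps one index for each value taken.\<close>
    obtain J where "J \<subseteq> I" "F x ` I = F x ` J" "inj_on (F x) J"
      using subset_image_inj[of "F x ` I" "F x" I] by auto
    then show "x \<in> (\<Union>J\<in>Pow I. P J)"
      using x by (auto simp: P_def FI)
  qed (auto simp: P_def FI)
  finally show "(\<lambda>x. (\<lambda>i. f i x) ` I) -` G \<inter> space N \<in> sets N" .
qed

text \<open>Each radius is half a lower bound for the distance to the other points. Basis sets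
  replace the balls so that countably many neighbourhoods suffice for all configurations.\<close>

lemma finite_disjoint_basis_nbhds:
  fixes \<phi> :: "'a::metric_space set"
  assumes "topological_basis \<B>" "finite \<phi>"
  obtains B where "\<And>x. x \<in> \<phi> \<Longrightarrow> B x \<in> \<B> \<and> x \<in> B x"
    "\<And>x y. x \<in> \<phi> \<Longrightarrow> y \<in> \<phi> \<Longrightarrow> x \<noteq> y \<Longrightarrow> B x \<inter> B y = {}"
proof -
  have "\<exists>d>0. \<forall>y\<in>\<phi>. y \<noteq> x \<longrightarrow> d \<le> dist x y" for x
    using finite_set_avoid[OF assms(2)] by blast
  then obtain d where d: "\<And>x. d x > 0" "\<And>x y. y \<in> \<phi> \<Longrightarrow> y \<noteq> x \<Longrightarrow> d x \<le> dist x y"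
    by metis
  have "\<exists>B\<in>\<B>. x \<in> B \<and> B \<subseteq> ball x (d x / 2)" for x
    using topological_basisE[OF assms(1) open_ball[of x "d x / 2"], of x] d(1)[of x]
    by (metis centre_in_ball half_gt_zero)
  then obtain B where B: "\<And>x. B x \<in> \<B>" "\<And>x. x \<in> B x" "\<And>x. B x \<subseteq> ball x (d x / 2)"
    by metis
  have "B x \<inter> B y = {}" if "x \<in> \<phi>" "y \<in> \<phi>" "x \<noteq> y" for x y
  proof (rule ccontr)
    assume "B x \<inter> B y \<noteq> {}"
    then obtain z where "z \<in> ball x (d x / 2)" "z \<in> ball y (d y / 2)"
      using B(3) by blast
    then have "dist x y < d x / 2 + d y / 2"
      using dist_triangle2[of x y z] by (simp add: dist_commute)
    then show False
      using d(2)[of y x] d(2)[of x y] that by (simp add: dist_commute)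
  qed
  then show ?thesis using B that by blast
qed

text \<open>The topology separates points, so that locally the points of a configuration can be labelled
  measurably. Hence measurability on configurations may be checked on tuples.\<close>

lemma measurable_configI:
  fixes X :: "'a::{second_countable_topology, metric_space} set"
    and g :: "nat \<Rightarrow> (nat \<Rightarrow> 'a) \<Rightarrow> 'b"
  assumes g: "\<And>k. g k \<in> measurable (PiM {1..k} (\<lambda>_. restrict_space borel X)) N"
    and eq: "\<And>k w. inj_on w {1..k} \<Longrightarrow> w \<in> {1..k} \<rightarrow>\<^sub>E X \<Longrightarrow> h (w ` {1..k}) = g k w"
  shows "h \<in> measurable (weak_borel X) N"
proof -
  obtain \<B> :: "'a set set" where \<B>: "countable \<B>" "topological_basis \<B>"
    using ex_countable_basis by blast
  have op: "open B" if "B \<in> \<B>" for B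
    using topological_basis_open[OF \<B>(2) that] .
  \<comment> \<open>Every configuration has exactly one point in each set of some list of disjoint
    basis sets and none elsewhere; the countably many lists thus give a cover.\<close>
  define \<L> where "\<L> = {Bs \<in> lists \<B>. \<forall>i<length Bs. \<forall>j<length Bs. i \<noteq> j \<longrightarrow> Bs ! i \<inter> Bs ! j = {}}"
  define \<Omega> where "\<Omega> Bs = {\<phi> \<in> configs X. card \<phi> = length Bs \<and>
      (\<forall>i\<in>{..<length Bs}. card (\<phi> \<inter> Bs ! i) = 1)}" for Bs
  have card_meas: "{\<phi> \<in> space (weak_borel X). card (\<phi> \<inter> B) = n} \<in> sets (weak_borel X)" if "open B" for B n
  proof -
    have "(\<lambda>\<phi>. card (\<phi> \<inter> B)) -` {n} \<inter> space (weak_borel X) \<in> sets (weak_borel X)"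
      using measurable_config_card[OF that] by (rule measurable_sets) auto
    then show ?thesis by (simp add: vimage_def Int_def conj_commute)
  qed
  show ?thesis
  proof (rule measurable_piecewise_restrict[where C = "\<Omega> ` \<L>"])
    show "countable (\<Omega> ` \<L>)"
      using \<B>(1) unfolding \<L>_def by (intro countable_image) (auto intro: countable_subset[of _ "lists \<B>"])
    show "space (weak_borel X) \<subseteq> \<Union> (\<Omega> ` \<L>)"
    proof
      fix \<phi> assume "\<phi> \<in> space (weak_borel X)"
      then have \<phi>: "finite \<phi>" "\<phi> \<subseteq> X" by (auto simp: configs_def)
      obtain B where B: "\<And>x. x \<in> \<phi> \<Longrightarrow> B x \<in> \<B> \<and> x \<in> B x"
        "\<And>x y. x \<in> \<phi> \<Longrightarrow> y \<in> \<phi> \<Longrightarrow> x \<noteq> y \<Longrightarrow> B x \<inter> B y = {}"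
        using finite_disjoint_basis_nbhds[OF \<B>(2) \<phi>(1)] by blast
      obtain xs where xs: "set xs = \<phi>" "distinct xs"
        using finite_distinct_list[OF \<phi>(1)] by blast
      have nth: "xs ! i \<in> \<phi>" if "i < length xs" for i using xs that by auto
      have "map B xs \<in> \<L>"
        using B nth xs by (auto simp: \<L>_def nth_eq_iff_index_eq)
      moreover have "\<phi> \<inter> B (xs ! i) = {xs ! i}" if "i < length xs" for i
        using B nth[OF that] by blast
      then have "\<phi> \<in> \<Omega> (map B xs)"
        using \<phi> xs distinct_card[of xs] by (auto simp: \<Omega>_def configs_def)
      ultimately show "\<phi> \<in> \<Union> (\<Omega> ` \<L>)" by blast
    qed
  next
    fix \<Omega>' assume "\<Omega>' \<in> \<Omega> ` \<L>"
    then obtain Bs where Bs: "Bs \<in> \<L>" "\<Omega>' = \<Omega> Bs" by blast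
    have opB: "open (Bs ! i)" if "i < length Bs" for i
      using Bs(1) that op by (auto simp: \<L>_def in_lists_conv_set)
    have "{\<phi> \<in> space (weak_borel X). card (\<phi> \<inter> UNIV) = length Bs} \<inter>
      {\<phi> \<in> space (weak_borel X). \<forall>i\<in>{..<length Bs}. card (\<phi> \<inter> Bs ! i) = 1} \<in> sets (weak_borel X)"
      using opB by (intro sets.Int card_meas sets.sets_Collect_finite_All) auto
    moreover have "{\<phi> \<in> space (weak_borel X). card (\<phi> \<inter> UNIV) = length Bs} \<inter>
      {\<phi> \<in> space (weak_borel X). \<forall>i\<in>{..<length Bs}. card (\<phi> \<inter> Bs ! i) = 1} = \<Omega>'"
      unfolding Bs(2) \<Omega>_def by auto
    ultimately have \<Omega>_sets: "\<Omega>' \<in> sets (weak_borel X)" by simp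
    then show \<Omega>_Int: "\<Omega>' \<inter> space (weak_borel X) \<in> sets (weak_borel X)"
      using sets.top by (rule sets.Int)
    define k where "k = length Bs"
    \<comment> \<open>The sets of the list act as labels; lists count from 0 and tuples from
      1.\<close>
    define pt where "pt \<phi> i = the_elem (\<phi> \<inter> Bs ! (i - 1))" for \<phi> and i :: nat
    have pt: "\<phi> \<inter> Bs ! (i - 1) = {pt \<phi> i}" if "\<phi> \<in> \<Omega>'" "i \<in> {1..k}" for \<phi> i
    proof -
      have "card (\<phi> \<inter> Bs ! (i - 1)) = 1"
        using that by (auto simp: Bs(2) \<Omega>_def k_def)
      then show ?thesis by (metis card_1_singletonE pt_def the_elem_eq)
    qed
    have pt_X: "pt \<phi> i \<in> X" if "\<phi> \<in> \<Omega>'" "i \<in> {1..k}" for \<phi> i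
      using pt[OF that] that(1) by (auto simp: Bs(2) \<Omega>_def configs_def)
    have disj: "Bs ! i \<inter> Bs ! j = {}" if "i < length Bs" "j < length Bs" "i \<noteq> j" for i j
      using Bs(1) that by (simp add: \<L>_def)
    have pt_inj: "inj_on (pt \<phi>) {1..k}" if "\<phi> \<in> \<Omega>'" for \<phi>
    proof (rule inj_onI, rule ccontr)
      fix i j assume ij: "i \<in> {1..k}" "j \<in> {1..k}" "pt \<phi> i = pt \<phi> j" "i \<noteq> j"
      have "Bs ! (i - 1) \<inter> Bs ! (j - 1) = {}"
      proof -
        have "i - 1 < length Bs" "j - 1 < length Bs" "i - 1 \<noteq> j - 1"
          using ij by (auto simp: k_def)
        then show ?thesis by (rule disj)
      qed
      moreover have "pt \<phi> i \<in> Bs ! (i - 1)" "pt \<phi> i \<in> Bs ! (j - 1)"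
        using pt[OF that ij(1)] pt[OF that ij(2)] ij(3) by auto
      ultimately show False by blast
    qed
    have pt_im: "pt \<phi> ` {1..k} = \<phi>" if "\<phi> \<in> \<Omega>'" for \<phi>
    proof (rule card_subset_eq)
      show "finite \<phi>" using that by (auto simp: Bs(2) \<Omega>_def configs_def)
      show "pt \<phi> ` {1..k} \<subseteq> \<phi>" using pt[OF that] by blast
      show "card (pt \<phi> ` {1..k}) = card \<phi>"
        using that card_image[OF pt_inj[OF that]] by (simp add: Bs(2) \<Omega>_def k_def)
    qed
    have pt_meas: "(\<lambda>\<phi>. pt \<phi> i) \<in> measurable (restrict_space (weak_borel X) \<Omega>') (restrict_space borel X)"
      if i: "i \<in> {1..k}" for i
    proof (rule measurable_restrict_space2)
      show "(\<lambda>\<phi>. pt \<phi> i) \<in> space (restrict_space (weak_borel X) \<Omega>') \<rightarrow> X"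
        using pt_X i by (auto simp: space_restrict_space)
      show "(\<lambda>\<phi>. pt \<phi> i) \<in> borel_measurable (restrict_space (weak_borel X) \<Omega>')"
      proof (rule borel_measurableI)
        fix C :: "'a set" assume C: "open C"
        \<comment> \<open>The labelled point lies in \<open>C\<close> exactly when the count in the
          smaller open set is still one, which reduces its measurability to that of counts.\<close>
        have "{\<phi> \<in> space (weak_borel X). card (\<phi> \<inter> (Bs ! (i - 1) \<inter> C)) = 1} \<inter> \<Omega>' \<in> sets (weak_borel X)"
          using i C opB \<Omega>_sets by (intro sets.Int card_meas open_Int) (auto simp: k_def)
        moreover have "card (\<phi> \<inter> (Bs ! (i - 1) \<inter> C)) = 1 \<longleftrightarrow> pt \<phi> i \<in> C" if "\<phi> \<in> \<Omega>'" for \<phi>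
        proof -
          have "\<phi> \<inter> (Bs ! (i - 1) \<inter> C) = {pt \<phi> i} \<inter> C" using pt[OF that i] by blast
          then show ?thesis by (cases "pt \<phi> i \<in> C") auto
        qed
        then have "{\<phi> \<in> space (weak_borel X). card (\<phi> \<inter> (Bs ! (i - 1) \<inter> C)) = 1} \<inter> \<Omega>'
            = (\<lambda>\<phi>. pt \<phi> i) -` C \<inter> space (restrict_space (weak_borel X) \<Omega>')"
          by (auto simp: space_restrict_space)
        ultimately have sC: "(\<lambda>\<phi>. pt \<phi> i) -` C \<inter> space (restrict_space (weak_borel X) \<Omega>')
            \<in> sets (weak_borel X)" by (rule back_subst[where P = "\<lambda>A. A \<in> sets (weak_borel X)"])
        show "(\<lambda>\<phi>. pt \<phi> i) -` C \<inter> space (restrict_space (weak_borel X) \<Omega>')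
            \<in> sets (restrict_space (weak_borel X) \<Omega>')"
          unfolding sets_restrict_space_iff[OF \<Omega>_Int] using sC by (simp only: space_restrict_space) blast
      qed
    qed
    have "(\<lambda>\<phi>. \<lambda>i\<in>{1..k}. pt \<phi> i) \<in> measurable (restrict_space (weak_borel X) \<Omega>')
        (PiM {1..k} (\<lambda>_. restrict_space borel X))"
      using pt_meas by (rule measurable_restrict)
    from measurable_compose[OF this g[of k]]
    have "(\<lambda>\<phi>. g k (\<lambda>i\<in>{1..k}. pt \<phi> i)) \<in> measurable (restrict_space (weak_borel X) \<Omega>') N" .
    also have "?this \<longleftrightarrow> h \<in> measurable (restrict_space (weak_borel X) \<Omega>') N"
    proof (rule measurable_cong)
      fix \<phi> assume "\<phi> \<in> space (restrict_space (weak_borel X) \<Omega>')"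
      then have \<phi>: "\<phi> \<in> \<Omega>'" by (simp add: space_restrict_space)
      have "h ((\<lambda>i\<in>{1..k}. pt \<phi> i) ` {1..k}) = g k (\<lambda>i\<in>{1..k}. pt \<phi> i)"
        using pt_inj[OF \<phi>] pt_X[OF \<phi>] by (intro eq) (simp_all add: inj_on_restrict_eq)
      then show "g k (\<lambda>i\<in>{1..k}. pt \<phi> i) = h \<phi>"
        using pt_im[OF \<phi>] by simp
    qed
    finally show "h \<in> measurable (restrict_space (weak_borel X) \<Omega>') N" .
  qed
qed

text \<open>\<open>f\<close> may merge points, so the image of a tuple without ties can have ties;
  \<open>measurable_image_config\<close> admits them.\<close>

lemma measurable_config_map:
  fixes X :: "'a::{second_countable_topology, metric_space} set"
    and f :: "'a \<Rightarrow> 'b::{second_countable_topology, metric_space}"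
  assumes f: "f \<in> borel_measurable (restrict_space borel X)" and fX: "f ` X \<subseteq> Y"
  shows "(\<lambda>\<phi>. f ` \<phi>) \<in> measurable (weak_borel X) (weak_borel Y)"
proof (rule measurable_configI)
  fix k :: nat
  show "(\<lambda>w. (\<lambda>i. f (w i)) ` {1..k}) \<in> measurable (PiM {1..k} (\<lambda>_. restrict_space borel X)) (weak_borel Y)"
  proof (rule measurable_image_config)
    show "(\<lambda>w. f (w i)) \<in> borel_measurable (PiM {1..k} (\<lambda>_. restrict_space borel X))"
      if "i \<in> {1..k}" for i
      using measurable_component_singleton[OF that] f by (rule measurable_compose)
    show "f (w i) \<in> Y" if "i \<in> {1..k}" "w \<in> space (PiM {1..k} (\<lambda>_. restrict_space borel X))" for i w
      using that fX by (auto simp: space_PiM space_restrict_space PiE_iff)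
  qed simp
qed (simp add: image_image)

section \<open>Measurability of the ground process and of the observation\<close>

lemma measurable_ground: "ground \<in> measurable (weak_borel (S \<times> marks)) (weak_borel S)"
proof -
  have "(\<lambda>w. fst ` w) \<in> measurable (weak_borel (S \<times> marks)) (weak_borel S)"
    by (rule measurable_config_map)
       (auto intro!: measurable_restrict_space1 borel_measurable_continuous_onI continuous_intros)
  then show ?thesis by (simp add: ground_def[abs_def])
qed

lemma shifted_eq_image: "shifted w = (\<lambda>(t, a, l). (t + a, l)) ` w"
  by (force simp: shifted_def)

lemma measurable_shifted: "shifted \<in> measurable (weak_borel (S \<times> marks)) (weak_borel marks)"
proof -
  have "(\<lambda>(t::real, a::real, l::real). (t + a, l)) \<in> borel_measurable borel"
    unfolding borel_prod[symmetric] by measurable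
  then have "(\<lambda>w. (\<lambda>(t, a, l). (t + a, l)) ` w) \<in> measurable (weak_borel (S \<times> marks)) (weak_borel marks)"
    by (intro measurable_config_map measurable_restrict_space1) (auto simp: marks_def)
  then show ?thesis by (simp add: shifted_eq_image[abs_def])
qed

section \<open>The marked Poisson process\<close>

lemma sets_mark_law [simp, measurable_cong]:
  "sets (mark_law R Y Z fY) = sets (restrict_space borel marks)"
  using sets.sets_measure_of_eq[of "restrict_space borel marks"]
  by (simp add: mark_law_def Let_def space_restrict_space)

lemma marks_borel [measurable]: "marks \<in> sets borel"
  unfolding marks_def by (intro borel_closed closed_Times) auto

lemma mark_region_borel [measurable]:
  "{(a, l). a \<le> 0 \<and> 0 \<le> a + l} \<in> sets (borel :: (real \<times> real) measure)"
proof -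
  have "{(a, l). a \<le> 0 \<and> 0 \<le> a + l} = {x :: real \<times> real. fst x \<le> 0} \<inter> {x. 0 \<le> fst x + snd x}"
    by auto
  then show ?thesis
    by (auto intro!: borel_closed closed_Int closed_Collect_le continuous_intros)
qed

text \<open>\<open>measure_of\<close> falls back to the null measure unless its set function is
  countably additive, so additivity has to be checked before the mark distribution can be
  evaluated.\<close>

lemma emeasure_mark_law:
  fixes R :: "'r measure" and Y Z :: "'r \<Rightarrow> real"
  defines "EY \<equiv> \<integral>\<omega>. Y \<omega> \<partial>R" and "EZ \<equiv> \<integral>\<omega>. Z \<omega> \<partial>R" and "ET \<equiv> \<integral>\<omega>. Y \<omega> + Z \<omega> \<partial>R"
  assumes fY: "fY \<in> borel_measurable borel"
  assumes B: "B \<in> sets (restrict_space borel marks)"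
  shows "emeasure (mark_law R Y Z fY) B =
    ennreal (EZ / ET) * indicator B (0, 0) + ennreal (EY / ET) *
      (\<integral>\<^sup>+(a, l). fY l / ennreal EY * indicator {(a, l). a \<le> 0 \<and> 0 \<le> a + l} (a, l)
         * indicator B (a, l) \<partial>lborel)"
proof -
  let ?h = "\<lambda>x :: real \<times> real. fY (snd x) / ennreal EY * indicator {(a, l). a \<le> 0 \<and> 0 \<le> a + l} x"
  let ?\<mu> = "\<lambda>B. ennreal (EZ / ET) * indicator B (0, 0) + ennreal (EY / ET) *
      (\<integral>\<^sup>+(a, l). fY l / ennreal EY * indicator {(a, l). a \<le> 0 \<and> 0 \<le> a + l} (a, l)
         * indicator B (a, l) \<partial>lborel)"
  have h [measurable]: "?h \<in> borel_measurable borel"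
    using fY by (simp add: borel_prod[symmetric])
  have eq: "mark_law R Y Z fY = measure_of marks (sets (restrict_space borel marks)) ?\<mu>"
    by (simp only: mark_law_def Let_def EY_def EZ_def ET_def)
  have "positive (sets (mark_law R Y Z fY)) ?\<mu>"
    unfolding positive_def case_prod_beta by simp
  moreover have "countably_additive (sets (mark_law R Y Z fY)) ?\<mu>"
  proof (rule countably_additiveI)
    fix A :: "nat \<Rightarrow> _" assume A: "range A \<subseteq> sets (mark_law R Y Z fY)" "disjoint_family A"
    have [measurable]: "A i \<in> sets borel" for i
    proof -
      have "A i \<in> sets (restrict_space borel marks)" using A(1) by auto
      then show ?thesis by (simp add: sets_restrict_space_iff marks_borel)
    qed
    have \<mu>: "?\<mu> B = ennreal (EZ / ET) * indicator B (0, 0) +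
        ennreal (EY / ET) * (\<integral>\<^sup>+x. ?h x * indicator B x \<partial>lborel)" for B
      unfolding case_prod_beta by simp
    have "(\<Sum>i. ?\<mu> (A i)) = ennreal (EZ / ET) * (\<Sum>i. indicator (A i) (0, 0)) +
        ennreal (EY / ET) * (\<Sum>i. \<integral>\<^sup>+x. ?h x * indicator (A i) x \<partial>lborel)"
      unfolding \<mu> by (simp flip: suminf_add)
    also have "(\<Sum>i. \<integral>\<^sup>+x. ?h x * indicator (A i) x \<partial>lborel) = (\<integral>\<^sup>+x. (\<Sum>i. ?h x * indicator (A i) x) \<partial>lborel)"
      by (rule nn_integral_suminf[symmetric]) measurable
    finally show "(\<Sum>i. ?\<mu> (A i)) = ?\<mu> (\<Union>i. A i)"
      unfolding \<mu> using A(2) by (simp add: suminf_indicator)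
  qed
  ultimately show ?thesis
    using B by (intro emeasure_measure_of[OF eq]) (auto simp: sets_restrict_space)
qed

text \<open>For a given length \<open>l\<close> the admissible left ends fill an interval of length
  \<open>l\<close>, so the integral for the continuous part is at most the mean of the positive part
  of \<open>Y\<close> divided by \<open>EY\<close>.\<close>

lemma finite_measure_mark_law:
  assumes Y: "distributed R lborel Y fY" and ET: "0 < (\<integral>\<omega>. Y \<omega> + Z \<omega> \<partial>R)"
  shows "finite_measure (mark_law R Y Z fY)"
proof (rule finite_measureI)
  define EY EZ ET where "EY = (\<integral>\<omega>. Y \<omega> \<partial>R)" and "EZ = (\<integral>\<omega>. Z \<omega> \<partial>R)"
    and "ET = (\<integral>\<omega>. Y \<omega> + Z \<omega> \<partial>R)"
  note defs = EY_def[symmetric] EZ_def[symmetric] ET_def[symmetric]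
  have fY [measurable]: "fY \<in> borel_measurable borel"
    using Y by (auto simp: distributed_def)
  let ?I = "\<integral>\<^sup>+(a, l). fY l / ennreal EY * indicator {(a, l). a \<le> 0 \<and> 0 \<le> a + l} (a, l)
         * indicator marks (a, l) \<partial>lborel"
  have "ennreal (EY / ET) * ?I < \<infinity>"
  proof (cases "EY > 0")
    case False
    \<comment> \<open>\<open>ennreal\<close> truncates the weight to 0, which settles this case
      whatever the integral is.\<close>
    then have "EY / ET \<le> 0" using ET by (simp add: defs divide_nonpos_pos)
    then show ?thesis by (simp add: ennreal_neg)
  next
    case True
    \<comment> \<open>The Bochner integral of a non-integrable function is 0 by convention, so a
      positive mean forces integrability.\<close>
    then have int: "integrable R Y"
      unfolding EY_def using not_integrable_integral_eq by force
    have "?I \<le> (\<integral>\<^sup>+x. fY (snd x) / ennreal EY * indicator {(a, l). a \<le> 0 \<and> 0 \<le> a + l} x \<partial>(lborel \<Otimes>\<^sub>M lborel))"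
      unfolding lborel_prod by (intro nn_integral_mono) (auto simp: indicator_def)
    also have "\<dots> = (\<integral>\<^sup>+l. \<integral>\<^sup>+a. fY l / ennreal EY * indicator {(a, l). a \<le> 0 \<and> 0 \<le> a + l} (a, l) \<partial>lborel \<partial>lborel)"
      by (subst lborel_pair.nn_integral_snd[symmetric]) (auto simp: borel_prod)
    also have "\<dots> = (\<integral>\<^sup>+l. fY l / ennreal EY * (\<integral>\<^sup>+a. indicator {-l..0} a \<partial>lborel) \<partial>lborel)"
      by (subst nn_integral_cmult[symmetric]) (auto simp: indicator_def intro!: nn_integral_cong)
    also have "\<dots> = (\<integral>\<^sup>+l. fY l * (ennreal l / ennreal EY) \<partial>lborel)"
      by (intro nn_integral_cong) (auto simp: emeasure_lborel_Icc_eq ennreal_neg divide_ennreal_def mult_ac)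
    also have "\<dots> = (\<integral>\<^sup>+\<omega>. ennreal (Y \<omega>) / ennreal EY \<partial>R)"
      by (rule distributed_nn_integral[OF Y]) simp
    also have "\<dots> = (\<integral>\<^sup>+\<omega>. ennreal (Y \<omega>) \<partial>R) / ennreal EY"
      using int by (intro nn_integral_divide) auto
    also have "\<dots> < \<infinity>"
    proof -
      have "(\<integral>\<^sup>+\<omega>. ennreal (Y \<omega>) \<partial>R) \<le> (\<integral>\<^sup>+\<omega>. ennreal (norm (Y \<omega>)) \<partial>R)"
        by (intro nn_integral_mono ennreal_leI) auto
      also have "\<dots> < \<infinity>" using int by (simp add: integrable_iff_bounded)
      finally show ?thesis using True by (simp add: ennreal_divide_eq_top_iff less_top[symmetric])
    qed
    finally show ?thesis by (simp add: ennreal_mult_less_top)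
  qed
  moreover have "marks \<in> sets (restrict_space borel marks)" by (simp add: sets_restrict_space_iff)
  moreover have "space (mark_law R Y Z fY) = marks"
    using sets_eq_imp_space_eq[OF sets_mark_law] by (simp add: space_restrict_space)
  moreover have "ennreal (EZ / ET) * indicator marks (0::real, 0::real) < \<infinity>"
    by (simp add: indicator_def)
  ultimately show "emeasure (mark_law R Y Z fY) (space (mark_law R Y Z fY)) \<noteq> \<infinity>"
    by (simp add: emeasure_mark_law[OF fY] defs less_top)
qed

text \<open>The Poisson law is prescribed by its values on events, with one integral for each number
  \<open>k\<close> of points; induction over simple functions and monotone limits carries the
  formula over to integrands.\<close>

lemma nn_integral_mixture:
  fixes c :: "nat \<Rightarrow> ennreal"
  assumes f [measurable]: "\<And>k. f k \<in> measurable (N k) M"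
    and M: "\<And>B. B \<in> sets M \<Longrightarrow> emeasure M B = (\<Sum>k. c k * (\<integral>\<^sup>+w. indicator B (f k w) \<partial>N k))"
    and h: "h \<in> borel_measurable M"
  shows "(\<integral>\<^sup>+x. h x \<partial>M) = (\<Sum>k. c k * (\<integral>\<^sup>+w. h (f k w) \<partial>N k))"
  using h
proof (induction rule: borel_measurable_induct)
  case (cong g h)
  have "(\<integral>\<^sup>+w. g (f k w) \<partial>N k) = (\<integral>\<^sup>+w. h (f k w) \<partial>N k)" for k
    using measurable_space[OF f] cong(3) by (intro nn_integral_cong) auto
  moreover have "(\<integral>\<^sup>+x. g x \<partial>M) = (\<integral>\<^sup>+x. h x \<partial>M)"
    using cong(3) by (intro nn_integral_cong) auto
  ultimately show ?case using cong by simp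
next
  case (set A)
  then show ?case by (simp add: M)
next
  case (mult g a)
  note [measurable] = mult(2)
  have "(\<integral>\<^sup>+w. a * g (f k w) \<partial>N k) = a * (\<integral>\<^sup>+w. g (f k w) \<partial>N k)" for k
    by (intro nn_integral_cmult) measurable
  then show ?case
    using mult by (simp add: nn_integral_cmult mult.left_commute)
next
  case (add u v)
  note [measurable] = add(1,3)
  have "(\<integral>\<^sup>+w. v (f k w) + u (f k w) \<partial>N k) = (\<integral>\<^sup>+w. v (f k w) \<partial>N k) + (\<integral>\<^sup>+w. u (f k w) \<partial>N k)" for k
    by (intro nn_integral_add) measurable
  moreover have "(\<integral>\<^sup>+x. v x + u x \<partial>M) = (\<integral>\<^sup>+x. v x \<partial>M) + (\<integral>\<^sup>+x. u x \<partial>M)"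
    by (intro nn_integral_add) measurable
  ultimately show ?case
    using add by (simp add: distrib_left suminf_add[symmetric])
next
  case (seq U)
  note [measurable] = seq(1)
  have mono: "incseq (\<lambda>i. c k * (\<integral>\<^sup>+w. U i (f k w) \<partial>N k))" for k
    using seq(3) by (auto intro!: incseq_SucI mult_left_mono nn_integral_mono simp: incseq_Suc_iff le_fun_def)
  have "(\<integral>\<^sup>+w. (SUP i. U i) (f k w) \<partial>N k) = (SUP i. \<integral>\<^sup>+w. U i (f k w) \<partial>N k)" for k
    unfolding SUP_apply using seq(3)
    by (intro nn_integral_monotone_convergence_SUP) (auto simp: incseq_def le_fun_def)
  then have "(\<Sum>k. c k * (\<integral>\<^sup>+w. (SUP i. U i) (f k w) \<partial>N k))
      = (\<Sum>k. SUP i. c k * (\<integral>\<^sup>+w. U i (f k w) \<partial>N k))"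
    by (simp add: SUP_mult_left_ennreal)
  also have "\<dots> = (SUP i. \<Sum>k. c k * (\<integral>\<^sup>+w. U i (f k w) \<partial>N k))"
    using mono by (rule ennreal_suminf_SUP_eq)
  also have "\<dots> = (SUP i. \<integral>\<^sup>+x. U i x \<partial>M)"
    using seq by simp
  also have "\<dots> = (\<integral>\<^sup>+x. (SUP i. U i) x \<partial>M)"
    unfolding SUP_apply using seq(3)
    by (intro nn_integral_monotone_convergence_SUP[symmetric]) auto
  finally show ?case by simp
qed

section \<open>Integration against the marked Poisson law\<close>

lemma measurable_tuple_config:
  fixes S :: "real set" and k :: nat
  assumes \<nu>: "sets \<nu> = sets (restrict_space borel marks)"
  shows "(\<lambda>w. w ` {1..k}) \<in> measurable (PiM {1..k} (\<lambda>_. restrict_space lborel S \<Otimes>\<^sub>M \<nu>)) (weak_borel (S \<times> marks))"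
proof -
  let ?P = "PiM {1..k} (\<lambda>_. restrict_space lborel S \<Otimes>\<^sub>M \<nu>)"
  have sp: "space \<nu> = marks"
    using sets_eq_imp_space_eq[OF \<nu>] by (simp add: space_restrict_space)
  have "(\<lambda>x. x) \<in> measurable \<nu> borel"
    unfolding measurable_cong_sets[OF \<nu> refl] by (intro measurable_restrict_space1) simp
  moreover have "(\<lambda>x. x) \<in> measurable (restrict_space lborel S) borel"
    by (intro measurable_restrict_space1) simp
  ultimately have "(\<lambda>x. (fst x, snd x)) \<in> borel_measurable (restrict_space lborel S \<Otimes>\<^sub>M \<nu>)"
    by (intro borel_measurable_Pair measurable_compose[OF measurable_fst] measurable_compose[OF measurable_snd])
  then have id: "(\<lambda>x. x) \<in> borel_measurable (restrict_space lborel S \<Otimes>\<^sub>M \<nu>)" by simp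
  show ?thesis
  proof (rule measurable_image_config[where f = "\<lambda>i w. w i" and I = "{1..k}" and X = "S \<times> marks" and N = ?P])
    show "(\<lambda>w. w i) \<in> borel_measurable ?P" if "i \<in> {1..k}" for i
      using measurable_component_singleton[OF that] id by (rule measurable_compose)
    show "w i \<in> S \<times> marks" if "i \<in> {1..k}" "w \<in> space ?P" for i w
      using that by (auto simp: space_PiM space_pair_measure space_restrict_space sp PiE_iff)
  qed simp
qed

lemma sets_marked_poisson [simp, measurable_cong]:
  "sets (marked_poisson S \<nu>) = sets (weak_borel (S \<times> marks))"
  using sets.sets_measure_of_eq[of "weak_borel (S \<times> marks)"]
  by (simp add: marked_poisson_def)

lemma nn_integral_marked_poisson:
  assumes \<nu>: "sets \<nu> = sets (restrict_space borel marks)"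
    and h: "h \<in> borel_measurable (weak_borel (S \<times> marks))"
  shows "(\<integral>\<^sup>+w. h w \<partial>marked_poisson S \<nu>) = (\<Sum>k. ennreal (exp (- measure lborel S) / fact k) *
          (\<integral>\<^sup>+w. h (w ` {1..k}) \<partial>(\<Pi>\<^sub>M i\<in>{1..k}. restrict_space lborel S \<Otimes>\<^sub>M \<nu>)))"
proof (rule nn_integral_mixture)
  show f: "(\<lambda>w. w ` {1..k}) \<in> measurable (\<Pi>\<^sub>M i\<in>{1..k}. restrict_space lborel S \<Otimes>\<^sub>M \<nu>) (marked_poisson S \<nu>)" for k :: nat
    unfolding measurable_cong_sets[OF refl sets_marked_poisson] by (rule measurable_tuple_config[OF \<nu>])
  show "h \<in> borel_measurable (marked_poisson S \<nu>)"
    using h by (simp cong: measurable_cong_sets)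
  fix B assume B: "B \<in> sets (marked_poisson S \<nu>)"
  show "emeasure (marked_poisson S \<nu>) B = (\<Sum>k. ennreal (exp (- measure lborel S) / fact k) *
          (\<integral>\<^sup>+w. indicator B (w ` {1..k}) \<partial>(\<Pi>\<^sub>M i\<in>{1..k}. restrict_space lborel S \<Otimes>\<^sub>M \<nu>)))"
  proof (rule emeasure_measure_of[OF marked_poisson_def])
    let ?c = "\<lambda>k. ennreal (exp (- measure lborel S) / fact k)"
    let ?P = "\<lambda>k::nat. \<Pi>\<^sub>M i\<in>{1..k}. restrict_space lborel S \<Otimes>\<^sub>M \<nu>"
    show "countably_additive (sets (marked_poisson S \<nu>)) (\<lambda>B. \<Sum>k. ?c k * (\<integral>\<^sup>+w. indicator B (w ` {1..k}) \<partial>?P k))"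
    proof (rule countably_additiveI)
      fix A :: "nat \<Rightarrow> _" assume A: "range A \<subseteq> sets (marked_poisson S \<nu>)" "disjoint_family A"
      have [measurable]: "(\<lambda>w. indicator (A i) (w ` {1..k}) :: ennreal) \<in> borel_measurable (?P k)" for i and k :: nat
        using A(1) by (intro measurable_compose[OF f]) auto
      have "(\<Sum>i. \<Sum>k. ?c k * (\<integral>\<^sup>+w. indicator (A i) (w ` {1..k}) \<partial>?P k))
          = (\<Sum>k. \<Sum>i. ?c k * (\<integral>\<^sup>+w. indicator (A i) (w ` {1..k}) \<partial>?P k))"
        \<comment> \<open>Two series of nonnegative terms are interchanged by reading the one over
          \<open>k\<close> as an integral over counting measure.\<close>
        using nn_integral_suminf[of "\<lambda>i k. ?c k * (\<integral>\<^sup>+w. indicator (A i) (w ` {1..k}) \<partial>?P k)" "count_space UNIV"]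
        by (simp add: nn_integral_count_space_nat)
      also have "\<dots> = (\<Sum>k. ?c k * (\<integral>\<^sup>+w. (\<Sum>i. indicator (A i) (w ` {1..k})) \<partial>?P k))"
      proof -
        have "(\<Sum>i. \<integral>\<^sup>+w. indicator (A i) (w ` {1..k}) \<partial>?P k) = (\<integral>\<^sup>+w. (\<Sum>i. indicator (A i) (w ` {1..k})) \<partial>?P k)" for k :: nat
          by (rule nn_integral_suminf[symmetric]) measurable
        then show ?thesis by (simp only: ennreal_suminf_cmult)
      qed
      finally show "(\<Sum>i. \<Sum>k. ?c k * (\<integral>\<^sup>+w. indicator (A i) (w ` {1..k}) \<partial>?P k))
          = (\<Sum>k. ?c k * (\<integral>\<^sup>+w. indicator (\<Union>i. A i) (w ` {1..k}) \<partial>?P k))"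
        using A(2) by (simp add: suminf_indicator)
    qed
  qed (use B sets.space_closed[of "weak_borel (S \<times> marks)"] in \<open>simp_all add: positive_def\<close>)
qed

text \<open>A product measure is determined by its values on boxes, and there weights, indicators
  and integrals all factorise over the index. Separating all \<open>y\<close> from all
  \<open>s\<close> keeps the observations fixed while the locations are integrated.\<close>

lemma nn_integral_PiM_representation:
  fixes \<alpha> :: "'a measure" and \<gamma> :: "'b measure" and N :: "'c measure" and I :: "'i set"
  assumes "sigma_finite_measure \<alpha>" "sigma_finite_measure \<gamma>" "sigma_finite_measure N"
    and I: "finite I"
    and \<omega> [measurable]: "(\<lambda>(y, s). \<omega> y s) \<in> borel_measurable (\<alpha> \<Otimes>\<^sub>M \<gamma>)"
    and \<Psi> [measurable]: "(\<lambda>(y, s). \<Psi> y s) \<in> measurable (\<alpha> \<Otimes>\<^sub>M \<gamma>) N"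
    and N: "\<And>E. E \<in> sets N \<Longrightarrow> emeasure N E = (\<integral>\<^sup>+y. \<integral>\<^sup>+s. \<omega> y s * indicator E (\<Psi> y s) \<partial>\<gamma> \<partial>\<alpha>)"
    and H [measurable]: "H \<in> borel_measurable (PiM I (\<lambda>_. N))"
  shows "(\<integral>\<^sup>+w. H w \<partial>PiM I (\<lambda>_. N)) =
    (\<integral>\<^sup>+y. \<integral>\<^sup>+s. (\<Prod>i\<in>I. \<omega> (y i) (s i)) * H (\<lambda>i\<in>I. \<Psi> (y i) (s i)) \<partial>PiM I (\<lambda>_. \<gamma>) \<partial>PiM I (\<lambda>_. \<alpha>))"
proof -
  interpret \<alpha>: product_sigma_finite "\<lambda>_. \<alpha>" by (simp add: product_sigma_finite_def assms)
  interpret \<gamma>: product_sigma_finite "\<lambda>_. \<gamma>" by (simp add: product_sigma_finite_def assms)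
  interpret N: product_sigma_finite "\<lambda>_. N" by (simp add: product_sigma_finite_def assms)
  interpret \<gamma>P: finite_product_sigma_finite "\<lambda>_. \<gamma>" I by standard (rule I)
  let ?Q = "PiM I (\<lambda>_. \<alpha>) \<Otimes>\<^sub>M PiM I (\<lambda>_. \<gamma>)"
  let ?d = "\<lambda>(y, s). \<Prod>i\<in>I. \<omega> (y i) (s i)"
  let ?\<Phi> = "\<lambda>(y, s). \<lambda>i\<in>I. \<Psi> (y i) (s i)"
  have c [measurable]: "(\<lambda>x. (fst x i, snd x i)) \<in> measurable ?Q (\<alpha> \<Otimes>\<^sub>M \<gamma>)" if "i \<in> I" for i
    using that by measurable
  have \<omega>i [measurable]: "(\<lambda>x. \<omega> (fst x i) (snd x i)) \<in> borel_measurable ?Q" if "i \<in> I" for i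
    using measurable_compose[OF c[OF that] \<omega>] by simp
  have \<Psi>i [measurable]: "(\<lambda>x. \<Psi> (fst x i) (snd x i)) \<in> measurable ?Q N" if "i \<in> I" for i
    using measurable_compose[OF c[OF that] \<Psi>] by simp
  have d [measurable]: "?d \<in> borel_measurable ?Q"
    unfolding case_prod_beta by (intro borel_measurable_prod_ennreal \<omega>i)
  have \<Phi> [measurable]: "?\<Phi> \<in> measurable ?Q (PiM I (\<lambda>_. N))"
    unfolding case_prod_beta by (intro measurable_restrict \<Psi>i)
  have "distr (density ?Q ?d) (PiM I (\<lambda>_. N)) ?\<Phi> = PiM I (\<lambda>_. N)"
  proof (rule N.PiM_eqI[OF I])
    fix A assume A: "\<And>i. i \<in> I \<Longrightarrow> A i \<in> sets N"
    have [measurable]: "Pi\<^sub>E I A \<in> sets (PiM I (\<lambda>_. N))"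
      using A I by (intro sets_PiM_I_finite) auto
    have m: "(\<lambda>(y, s). \<omega> y s * indicator (A i) (\<Psi> y s)) \<in> borel_measurable (\<alpha> \<Otimes>\<^sub>M \<gamma>)" if "i \<in> I" for i
      using A[OF that] by measurable
    have "emeasure (distr (density ?Q ?d) (PiM I (\<lambda>_. N)) ?\<Phi>) (Pi\<^sub>E I A)
        = (\<integral>\<^sup>+x. ?d x * indicator (Pi\<^sub>E I A) (?\<Phi> x) \<partial>?Q)"
      by (simp add: nn_integral_indicator[symmetric] nn_integral_distr nn_integral_density
               del: nn_integral_indicator)
    also have "\<dots> = (\<integral>\<^sup>+y. \<integral>\<^sup>+s. ?d (y, s) * indicator (Pi\<^sub>E I A) (?\<Phi> (y, s)) \<partial>PiM I (\<lambda>_. \<gamma>) \<partial>PiM I (\<lambda>_. \<alpha>))"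
      by (rule \<gamma>P.nn_integral_fst[symmetric]) measurable
    also have "\<dots> = (\<integral>\<^sup>+y. \<integral>\<^sup>+s. (\<Prod>i\<in>I. \<omega> (y i) (s i) * indicator (A i) (\<Psi> (y i) (s i))) \<partial>PiM I (\<lambda>_. \<gamma>) \<partial>PiM I (\<lambda>_. \<alpha>))"
    proof (intro nn_integral_cong)
      fix y s
      have "indicator (Pi\<^sub>E I A) (?\<Phi> (y, s)) = (\<Prod>i\<in>I. indicator (A i) (\<Psi> (y i) (s i)) :: ennreal)"
      proof (cases "\<forall>i\<in>I. \<Psi> (y i) (s i) \<in> A i")
        case True then show ?thesis by (simp add: indicator_def)
      next
        case False
        then have "?\<Phi> (y, s) \<notin> Pi\<^sub>E I A" by auto
        moreover have "(\<Prod>i\<in>I. indicator (A i) (\<Psi> (y i) (s i)) :: ennreal) = 0"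
          using False I by (auto simp: prod_zero_iff indicator_def)
        ultimately show ?thesis by simp
      qed
      then show "?d (y, s) * indicator (Pi\<^sub>E I A) (?\<Phi> (y, s)) = (\<Prod>i\<in>I. \<omega> (y i) (s i) * indicator (A i) (\<Psi> (y i) (s i)))"
        by (simp add: prod.distrib)
    qed
    also have "\<dots> = (\<integral>\<^sup>+y. (\<Prod>i\<in>I. \<integral>\<^sup>+s. \<omega> (y i) s * indicator (A i) (\<Psi> (y i) s) \<partial>\<gamma>) \<partial>PiM I (\<lambda>_. \<alpha>))"
    proof (intro nn_integral_cong \<gamma>.product_nn_integral_prod I)
      fix y i assume "y \<in> space (PiM I (\<lambda>_. \<alpha>))" "i \<in> I"
      then have "y i \<in> space \<alpha>" by (auto simp: space_PiM)
      then show "(\<lambda>s. \<omega> (y i) s * indicator (A i) (\<Psi> (y i) s)) \<in> borel_measurable \<gamma>"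
        using measurable_compose[OF measurable_Pair1' m[OF \<open>i \<in> I\<close>]] by simp
    qed
    also have "\<dots> = (\<Prod>i\<in>I. \<integral>\<^sup>+y. \<integral>\<^sup>+s. \<omega> y s * indicator (A i) (\<Psi> y s) \<partial>\<gamma> \<partial>\<alpha>)"
      using m by (intro \<alpha>.product_nn_integral_prod I sigma_finite_measure.borel_measurable_nn_integral assms(2))
    also have "\<dots> = (\<Prod>i\<in>I. emeasure N (A i))"
      using A N by simp
    finally show "emeasure (distr (density ?Q ?d) (PiM I (\<lambda>_. N)) ?\<Phi>) (Pi\<^sub>E I A) = (\<Prod>i\<in>I. emeasure N (A i))" .
  qed simp
  then have "(\<integral>\<^sup>+w. H w \<partial>PiM I (\<lambda>_. N)) = (\<integral>\<^sup>+w. H w \<partial>distr (density ?Q ?d) (PiM I (\<lambda>_. N)) ?\<Phi>)"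
    by simp
  also have "\<dots> = (\<integral>\<^sup>+x. ?d x * H (?\<Phi> x) \<partial>?Q)"
    by (simp add: nn_integral_distr nn_integral_density)
  also have "\<dots> = (\<integral>\<^sup>+y. \<integral>\<^sup>+s. ?d (y, s) * H (?\<Phi> (y, s)) \<partial>PiM I (\<lambda>_. \<gamma>) \<partial>PiM I (\<lambda>_. \<alpha>))"
    by (rule \<gamma>P.nn_integral_fst[symmetric]) measurable
  finally show ?thesis by simp
qed

text \<open>Coordinates outside the range of \<open>\<pi>\<close> integrate to the total mass, whence the
  normalising power.\<close>

lemma nn_integral_PiM_coordinates:
  fixes \<gamma> :: "'b measure" and \<pi> :: "'j \<Rightarrow> 'i"
  assumes \<gamma>: "finite_measure \<gamma>" and I: "finite I" "finite J"
    and \<pi>: "inj_on \<pi> J" "\<pi> ` J \<subseteq> I"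
    and pos: "card J < card I \<Longrightarrow> emeasure \<gamma> (space \<gamma>) \<noteq> 0"
    and f [measurable]: "f \<in> borel_measurable (PiM J (\<lambda>_. \<gamma>))"
  shows "(\<integral>\<^sup>+x. f x \<partial>PiM J (\<lambda>_. \<gamma>)) =
    (\<integral>\<^sup>+s. inverse (emeasure \<gamma> (space \<gamma>)) ^ (card I - card J) * f (\<lambda>j\<in>J. s (\<pi> j)) \<partial>PiM I (\<lambda>_. \<gamma>))"
proof -
  interpret \<gamma>: finite_measure \<gamma> by fact
  interpret P: product_sigma_finite "\<lambda>_. \<gamma>"
    by (simp add: product_sigma_finite_def \<gamma>.sigma_finite_measure_axioms)
  let ?c = "inverse (emeasure \<gamma> (space \<gamma>)) ^ (card I - card J)"
  let ?\<Phi> = "\<lambda>s. \<lambda>j\<in>J. s (\<pi> j)"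
  have [measurable]: "?\<Phi> \<in> measurable (PiM I (\<lambda>_. \<gamma>)) (PiM J (\<lambda>_. \<gamma>))"
    using \<pi> by (intro measurable_restrict measurable_component_singleton) auto
  have "distr (density (PiM I (\<lambda>_. \<gamma>)) (\<lambda>_. ?c)) (PiM J (\<lambda>_. \<gamma>)) ?\<Phi> = PiM J (\<lambda>_. \<gamma>)"
  proof (rule P.PiM_eqI[OF I(2)])
    fix A assume A: "\<And>j. j \<in> J \<Longrightarrow> A j \<in> sets \<gamma>"
    \<comment> \<open>Coordinates outside the range of \<open>\<pi>\<close> are left unconstrained,
      which makes the preimage of a box again a box.\<close>
    define B where "B i = (if i \<in> \<pi> ` J then A (the_inv_into J \<pi> i) else space \<gamma>)" for i
    have B\<pi>: "B (\<pi> j) = A j" if "j \<in> J" for j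
      using that \<pi>(1) by (simp add: B_def the_inv_into_f_f)
    have Bs: "B i \<in> sets \<gamma>" for i
      using A \<pi>(1) by (auto simp: B_def the_inv_into_f_f)
    have [measurable]: "Pi\<^sub>E J A \<in> sets (PiM J (\<lambda>_. \<gamma>))"
      using A I by (intro sets_PiM_I_finite) auto
    have "emeasure (distr (density (PiM I (\<lambda>_. \<gamma>)) (\<lambda>_. ?c)) (PiM J (\<lambda>_. \<gamma>)) ?\<Phi>) (Pi\<^sub>E J A)
        = (\<integral>\<^sup>+s. ?c * indicator (Pi\<^sub>E J A) (?\<Phi> s) \<partial>PiM I (\<lambda>_. \<gamma>))"
      by (simp add: nn_integral_indicator[symmetric] nn_integral_distr nn_integral_density
               del: nn_integral_indicator)
    also have "\<dots> = (\<integral>\<^sup>+s. ?c * indicator (Pi\<^sub>E I B) s \<partial>PiM I (\<lambda>_. \<gamma>))"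
    proof (intro nn_integral_cong)
      fix s assume s: "s \<in> space (PiM I (\<lambda>_. \<gamma>))"
      have "?\<Phi> s \<in> Pi\<^sub>E J A \<longleftrightarrow> s \<in> Pi\<^sub>E I B"
      proof
        assume *: "?\<Phi> s \<in> Pi\<^sub>E J A"
        have "s i \<in> B i" if "i \<in> I" for i
        proof (cases "i \<in> \<pi> ` J")
          case True
          then obtain j where "j \<in> J" "i = \<pi> j" by blast
          then show ?thesis using * by (auto simp: B\<pi>)
        next
          case False
          then show ?thesis using s that by (auto simp: B_def space_PiM)
        qed
        then show "s \<in> Pi\<^sub>E I B" using s by (auto simp: space_PiM PiE_iff)
      next
        assume "s \<in> Pi\<^sub>E I B"
        then show "?\<Phi> s \<in> Pi\<^sub>E J A"
          using \<pi>(2) B\<pi> by (auto simp: PiE_iff)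
      qed
      then show "?c * indicator (Pi\<^sub>E J A) (?\<Phi> s) = ?c * indicator (Pi\<^sub>E I B) s"
        by (simp add: indicator_def)
    qed
    also have "\<dots> = ?c * (\<Prod>i\<in>I. emeasure \<gamma> (B i))"
      using Bs I by (simp add: nn_integral_cmult_indicator sets_PiM_I_finite P.emeasure_PiM)
    also have "(\<Prod>i\<in>I. emeasure \<gamma> (B i)) = (\<Prod>i\<in>I - \<pi> ` J. emeasure \<gamma> (B i)) * (\<Prod>i\<in>\<pi> ` J. emeasure \<gamma> (B i))"
      using \<pi> I by (intro prod.subset_diff) auto
    also have "(\<Prod>i\<in>I - \<pi> ` J. emeasure \<gamma> (B i)) = emeasure \<gamma> (space \<gamma>) ^ (card I - card J)"
      using \<pi> I by (simp add: B_def card_Diff_subset card_image)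
    also have "(\<Prod>i\<in>\<pi> ` J. emeasure \<gamma> (B i)) = (\<Prod>j\<in>J. emeasure \<gamma> (A j))"
      using \<pi> by (simp add: prod.reindex B\<pi>)
    also have "?c * (emeasure \<gamma> (space \<gamma>) ^ (card I - card J) * (\<Prod>j\<in>J. emeasure \<gamma> (A j))) = (\<Prod>j\<in>J. emeasure \<gamma> (A j))"
    \<comment> \<open>The inverse cancels only against a mass that is neither 0 nor infinite; when
      no coordinate is free, the exponent is 0 and a null mass does no harm.\<close>
    proof (cases "card J < card I")
      case True
      then have "emeasure \<gamma> (space \<gamma>) / emeasure \<gamma> (space \<gamma>) = 1"
        using pos \<gamma>.emeasure_finite by (intro ennreal_divide_self) (auto simp: less_top[symmetric])
      then have "inverse (emeasure \<gamma> (space \<gamma>)) * emeasure \<gamma> (space \<gamma>) = 1"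
        by (simp add: divide_ennreal_def mult.commute)
      then show ?thesis by (simp add: mult.assoc[symmetric] power_mult_distrib[symmetric])
    qed simp
    finally show "emeasure (distr (density (PiM I (\<lambda>_. \<gamma>)) (\<lambda>_. ?c)) (PiM J (\<lambda>_. \<gamma>)) ?\<Phi>) (Pi\<^sub>E J A)
        = (\<Prod>j\<in>J. emeasure \<gamma> (A j))" .
  qed simp
  then have "(\<integral>\<^sup>+x. f x \<partial>PiM J (\<lambda>_. \<gamma>))
      = (\<integral>\<^sup>+x. f x \<partial>distr (density (PiM I (\<lambda>_. \<gamma>)) (\<lambda>_. ?c)) (PiM J (\<lambda>_. \<gamma>)) ?\<Phi>)"
    by simp
  also have "\<dots> = (\<integral>\<^sup>+s. ?c * f (?\<Phi> s) \<partial>PiM I (\<lambda>_. \<gamma>))"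
    by (simp add: nn_integral_distr nn_integral_density)
  finally show ?thesis .
qed

section \<open>Disintegration along the observed pair\<close>

text \<open>A marked point is parametrised by its observation \<open>(a, l)\<close> and, if \<open>l > 0\<close>, by its
  location \<open>s \<in> S\<close>. The Boolean flag distinguishes atoms, for which \<open>l\<close> and \<open>s\<close> are dummies
  that are integrated out to total mass one; this makes all reference measures Lebesgue.\<close>

definition latent_measure :: "(bool \<times> real \<times> real) measure" where
  "latent_measure = count_space UNIV \<Otimes>\<^sub>M (lborel \<Otimes>\<^sub>M lborel)"

text \<open>\<open>max 0\<close> keeps every value in \<open>marks\<close>; for intervals,
  \<open>latent_density\<close> vanishes at the negative lengths affected.\<close>

definition observation :: "bool \<times> real \<times> real \<Rightarrow> real \<times> real" where
  "observation y = (fst (snd y), if fst y then 0 else max 0 (snd (snd y)))"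

definition latent_density :: "ennreal \<Rightarrow> (real \<Rightarrow> ennreal) \<Rightarrow> real set \<Rightarrow> bool \<times> real \<times> real \<Rightarrow> ennreal" where
  "latent_density c g S y =
     (if fst y then c * indicator S (fst (snd y)) * indicator {0..1} (snd (snd y))
      else g (snd (snd y)) * indicator {0<..} (snd (snd y)))"

text \<open>The case distinction is on the length and not on the flag, because the conditional law
  must be a function of the observation alone; where \<open>latent_density\<close> is nonzero, both
  distinctions agree.\<close>

definition window :: "real set \<Rightarrow> real \<times> real \<Rightarrow> real \<Rightarrow> ennreal" where
  "window S v s = (if snd v = 0 then inverse (emeasure lborel S) else indicator {fst v..fst v + snd v} s)"

text \<open>The clause \<open>fst v \<in> S\<close> makes the value lie in \<open>S\<close> for
  every observation \<open>v\<close> once \<open>s\<close> does, so that all sets of locations are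
  configurations in \<open>S\<close>.\<close>

definition location :: "real set \<Rightarrow> real \<times> real \<Rightarrow> real \<Rightarrow> real" where
  "location S v s = (if snd v = 0 \<and> fst v \<in> S then fst v else s)"

definition marked_point :: "real set \<Rightarrow> real \<times> real \<Rightarrow> real \<Rightarrow> real \<times> real \<times> real" where
  "marked_point S v s = (location S v s, fst v - location S v s, snd v)"

lemma measurable_observation [measurable]: "observation \<in> measurable latent_measure (borel \<Otimes>\<^sub>M borel)"
  unfolding observation_def latent_measure_def by measurable

lemma measurable_latent_density [measurable]:
  assumes [measurable]: "g \<in> borel_measurable borel" "S \<in> sets borel"
  shows "latent_density c g S \<in> borel_measurable latent_measure"
  unfolding latent_density_def latent_measure_def by measurable

lemma measurable_window [measurable]:
  "(\<lambda>(v, s). window S v s) \<in> borel_measurable ((borel \<Otimes>\<^sub>M borel) \<Otimes>\<^sub>M borel)"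
proof -
  have "window S v s = (if snd v = 0 then inverse (emeasure lborel S)
      else if fst v \<le> s \<and> s \<le> fst v + snd v then 1 else 0)" for v s
    by (auto simp: window_def)
  then show ?thesis by simp
qed

lemma measurable_location [measurable]:
  assumes [measurable]: "S \<in> sets borel"
  shows "(\<lambda>(v, s). location S v s) \<in> borel_measurable ((borel \<Otimes>\<^sub>M borel) \<Otimes>\<^sub>M borel)"
  unfolding location_def by measurable

lemma measurable_marked_point [measurable]:
  assumes [measurable]: "S \<in> sets borel"
  shows "(\<lambda>(v, s). marked_point S v s) \<in> measurable ((borel \<Otimes>\<^sub>M borel) \<Otimes>\<^sub>M borel) (borel \<Otimes>\<^sub>M (borel \<Otimes>\<^sub>M borel))"
  unfolding marked_point_def by measurable

lemma measurable_id_restrict_lborel [measurable]: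
  "(\<lambda>x. x) \<in> measurable (restrict_space lborel S) borel"
  by (intro measurable_restrict_space1) simp

lemma sigma_finite_latent_measure: "sigma_finite_measure latent_measure"
proof -
  interpret pair_sigma_finite "count_space (UNIV :: bool set)" "lborel \<Otimes>\<^sub>M lborel :: (real \<times> real) measure"
    by (intro pair_sigma_finite.intro sigma_finite_measure_count_space_finite
        lborel_pair.sigma_finite_measure_axioms) simp
  show ?thesis unfolding latent_measure_def by (rule sigma_finite_measure_axioms)
qed

lemma finite_measure_restrict_lborel:
  assumes "S \<in> sets borel" "emeasure lborel S < \<infinity>"
  shows "finite_measure (restrict_space lborel S)"
  using assms by (intro finite_measureI) (auto simp: emeasure_restrict_space space_restrict_space)

lemma sets_location_mark_borel:
  fixes S :: "real set"
  assumes S: "S \<in> sets borel" and \<nu>: "sets \<nu> = sets (restrict_space borel marks)"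
    and E: "E \<in> sets (restrict_space lborel S \<Otimes>\<^sub>M \<nu>)"
  shows "E \<in> sets (borel \<Otimes>\<^sub>M (borel \<Otimes>\<^sub>M borel))"
proof -
  have "sets (restrict_space lborel S \<Otimes>\<^sub>M \<nu>) \<subseteq> sets (borel \<Otimes>\<^sub>M borel)"
    unfolding sets_pair_measure[of "restrict_space lborel S" \<nu>]
  proof (rule sets.sigma_sets_subset', safe)
    fix A B assume "A \<in> sets (restrict_space lborel S)" "B \<in> sets \<nu>"
    then have "A \<in> sets borel" "B \<in> sets borel"
      using S by (simp_all add: \<nu> sets_restrict_space_iff marks_borel)
    then show "A \<times> B \<in> sets (borel \<Otimes>\<^sub>M borel)" by auto
  next
    have "space \<nu> = marks" using sets_eq_imp_space_eq[OF \<nu>] by (simp add: space_restrict_space)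
    then show "space (restrict_space lborel S) \<times> space \<nu> \<in> sets (borel \<Otimes>\<^sub>M borel)"
      using S marks_borel by (simp add: space_restrict_space)
  qed
  from subsetD[OF this E] show ?thesis by (simp only: borel_prod)
qed

text \<open>Openness makes division by the mass of \<open>S\<close> legitimate as soon as a single
  atom is observed in \<open>S\<close>.\<close>

lemma open_emeasure_pos:
  fixes S :: "real set"
  assumes "open S" "x \<in> S" shows "emeasure lborel S \<noteq> 0"
  using assms open_not_negligible[of S] by (auto simp: negligible_iff_emeasure0 emeasure_completion)

text \<open>Translating by a fixed location \<open>t\<close> turns the region a \<le> 0 \<le> a + l
  into the event that \<open>t\<close> lies in the observed interval, and Lebesgue measure is
  invariant under this. The atom of the mark distribution leaves the location itself as the
  observation.\<close>

lemma emeasure_location_mark: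
  fixes S :: "real set"
  assumes S: "open S" "emeasure lborel S < \<infinity>"
    and fin: "finite_measure \<nu>" and \<nu>: "sets \<nu> = sets (restrict_space borel marks)"
    and g [measurable]: "g \<in> borel_measurable borel"
    and em: "\<And>B. B \<in> sets \<nu> \<Longrightarrow> emeasure \<nu> B = c * indicator B (0, 0) +
      (\<integral>\<^sup>+x. g (snd x) * indicator {(a, l). a \<le> 0 \<and> 0 \<le> a + l} x * indicator B x \<partial>(lborel \<Otimes>\<^sub>M lborel))"
    and E: "E \<in> sets (restrict_space lborel S \<Otimes>\<^sub>M \<nu>)"
  shows "emeasure (restrict_space lborel S \<Otimes>\<^sub>M \<nu>) E =
    (\<integral>\<^sup>+y. \<integral>\<^sup>+s. latent_density c g S y * window S (observation y) s *
      indicator E (marked_point S (observation y) s) \<partial>restrict_space lborel S \<partial>latent_measure)"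
proof -
  let ?LS = "restrict_space lborel S"
  let ?R = "{(a, l). a \<le> 0 \<and> 0 \<le> a + l} :: (real \<times> real) set"
  have Sb [measurable]: "S \<in> sets borel" using S(1) by simp
  have Eb [measurable]: "E \<in> sets (borel \<Otimes>\<^sub>M (borel \<Otimes>\<^sub>M borel))"
    using sets_location_mark_borel[OF Sb \<nu> E] .
  have Rb [measurable]: "?R \<in> sets (borel \<Otimes>\<^sub>M borel)"
    unfolding borel_prod by (rule mark_region_borel)
  interpret \<nu>: finite_measure \<nu> by fact
  interpret LS: finite_measure ?LS by (rule finite_measure_restrict_lborel[OF Sb S(2)])
  interpret LP: pair_sigma_finite ?LS "lborel \<Otimes>\<^sub>M lborel :: (real \<times> real) measure"
    by (intro pair_sigma_finite.intro LS.sigma_finite_measure_axioms lborel_pair.sigma_finite_measure_axioms)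
  let ?F = "\<lambda>y s. latent_density c g S y * window S (observation y) s * indicator E (marked_point S (observation y) s)"
  have w [measurable]: "(\<lambda>x. window S (observation (fst x)) (snd x)) \<in> borel_measurable (latent_measure \<Otimes>\<^sub>M ?LS)"
    "(\<lambda>x. marked_point S (observation (fst x)) (snd x)) \<in> measurable (latent_measure \<Otimes>\<^sub>M ?LS) (borel \<Otimes>\<^sub>M (borel \<Otimes>\<^sub>M borel))"
  proof -
    have *: "(\<lambda>x. (observation (fst x), snd x)) \<in> measurable (latent_measure \<Otimes>\<^sub>M ?LS) ((borel \<Otimes>\<^sub>M borel) \<Otimes>\<^sub>M borel)"
      by measurable
    show "(\<lambda>x. window S (observation (fst x)) (snd x)) \<in> borel_measurable (latent_measure \<Otimes>\<^sub>M ?LS)"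
      using measurable_compose[OF * measurable_window] by simp
    show "(\<lambda>x. marked_point S (observation (fst x)) (snd x)) \<in> measurable (latent_measure \<Otimes>\<^sub>M ?LS) (borel \<Otimes>\<^sub>M (borel \<Otimes>\<^sub>M borel))"
      using measurable_compose[OF * measurable_marked_point[OF Sb]] by simp
  qed
  have F [measurable]: "(\<lambda>(y, s). ?F y s) \<in> borel_measurable (latent_measure \<Otimes>\<^sub>M ?LS)"
    unfolding case_prod_beta by measurable

  have "(\<integral>\<^sup>+y. \<integral>\<^sup>+s. ?F y s \<partial>?LS \<partial>latent_measure)
      = (\<integral>\<^sup>+b. \<integral>\<^sup>+x. \<integral>\<^sup>+s. ?F (b, x) s \<partial>?LS \<partial>(lborel \<Otimes>\<^sub>M lborel) \<partial>count_space UNIV)"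
    using F unfolding latent_measure_def
    by (intro lborel_pair.nn_integral_fst[symmetric, where f = "\<lambda>y. \<integral>\<^sup>+s. ?F y s \<partial>?LS", simplified]
        LS.borel_measurable_nn_integral)
  also have "\<dots> = (\<integral>\<^sup>+x. \<integral>\<^sup>+s. ?F (True, x) s \<partial>?LS \<partial>(lborel \<Otimes>\<^sub>M lborel))
      + (\<integral>\<^sup>+x. \<integral>\<^sup>+s. ?F (False, x) s \<partial>?LS \<partial>(lborel \<Otimes>\<^sub>M lborel))"
    by (simp add: nn_integral_count_space_finite UNIV_bool add.commute)
  \<comment> \<open>For atoms the inverse mass in \<open>window\<close> cancels the mass of the
    dummy location, and the dummy length runs over the unit interval.\<close>
  also have "(\<integral>\<^sup>+x. \<integral>\<^sup>+s. ?F (True, x) s \<partial>?LS \<partial>(lborel \<Otimes>\<^sub>M lborel))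
      = (\<integral>\<^sup>+x. c * indicator S (fst x) * indicator {0..1::real} (snd x) * indicator E (fst x, 0, 0) \<partial>(lborel \<Otimes>\<^sub>M lborel))"
  proof (intro nn_integral_cong)
    fix x :: "real \<times> real"
    show "(\<integral>\<^sup>+s. ?F (True, x) s \<partial>?LS) = c * indicator S (fst x) * indicator {0..1} (snd x) * indicator E (fst x, 0, 0)"
    proof (cases "fst x \<in> S")
      case True
      have "emeasure lborel S \<noteq> 0"
        using S(1) True by (rule open_emeasure_pos)
      then have "emeasure lborel S / emeasure lborel S = 1"
        using S(2) by (intro ennreal_divide_self) auto
      then have inv: "inverse (emeasure lborel S) * emeasure lborel S = 1"
        by (simp add: divide_ennreal_def mult.commute)
      have "(\<integral>\<^sup>+s. ?F (True, x) s \<partial>?LS) = (\<integral>\<^sup>+s. c * indicator {0..1} (snd x) * inverse (emeasure lborel S) * indicator E (fst x, 0, 0) \<partial>?LS)"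
        using True by (simp add: latent_density_def observation_def window_def marked_point_def location_def)
      also have "\<dots> = c * indicator {0..1} (snd x) * (inverse (emeasure lborel S) * emeasure lborel S) * indicator E (fst x, 0, 0)"
        using Sb by (simp add: emeasure_restrict_space space_restrict_space mult_ac)
      finally show ?thesis using True by (simp add: inv)
    qed (simp add: latent_density_def)
  qed
  also have "\<dots> = (\<integral>\<^sup>+a. \<integral>\<^sup>+l. c * indicator S a * indicator E (a, 0, 0) * indicator {0..1::real} l \<partial>lborel \<partial>lborel)"
    by (subst lborel.nn_integral_fst[symmetric]) (auto simp: mult_ac)
  also have "\<dots> = (\<integral>\<^sup>+a. c * indicator S a * indicator E (a, 0, 0) \<partial>lborel)"
    by (simp add: nn_integral_cmult_indicator)
  also have "\<dots> = (\<integral>\<^sup>+t. c * indicator E (t, 0, 0) \<partial>?LS)"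
    by (subst nn_integral_restrict_space) (auto simp: mult_ac)
  also have "(\<integral>\<^sup>+x. \<integral>\<^sup>+s. ?F (False, x) s \<partial>?LS \<partial>(lborel \<Otimes>\<^sub>M lborel))
      = (\<integral>\<^sup>+s. \<integral>\<^sup>+x. ?F (False, x) s \<partial>(lborel \<Otimes>\<^sub>M lborel) \<partial>?LS)"
  proof (rule LP.Fubini')
    have "(\<lambda>z. ((False, snd z), fst z)) \<in> measurable (?LS \<Otimes>\<^sub>M (lborel \<Otimes>\<^sub>M lborel)) (latent_measure \<Otimes>\<^sub>M ?LS)"
      unfolding latent_measure_def by measurable
    from measurable_compose[OF this F]
    show "(\<lambda>(s, x). ?F (False, x) s) \<in> borel_measurable (?LS \<Otimes>\<^sub>M (lborel \<Otimes>\<^sub>M lborel))"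
      by (simp add: case_prod_beta)
  qed
  also have "\<dots> = (\<integral>\<^sup>+s. \<integral>\<^sup>+x. g (snd x) * indicator ?R x * indicator E (s, x) \<partial>(lborel \<Otimes>\<^sub>M lborel) \<partial>?LS)"
  proof (rule nn_integral_cong)
    fix s
    have "(\<integral>\<^sup>+x. ?F (False, x) s \<partial>(lborel \<Otimes>\<^sub>M lborel))
        = (\<integral>\<^sup>+x. g (snd x) * indicator {0<..} (snd x) * (if fst x \<le> s \<and> s \<le> fst x + snd x then 1 else 0)
            * indicator E (s, fst x - s, snd x) \<partial>(lborel \<Otimes>\<^sub>M lborel))"
      by (intro nn_integral_cong)
         (auto simp: latent_density_def observation_def window_def marked_point_def location_def indicator_def)
    also have "\<dots> = (\<integral>\<^sup>+l. \<integral>\<^sup>+a. g l * indicator {0<..} l * (if a \<le> s \<and> s \<le> a + l then 1 else 0)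
            * indicator E (s, a - s, l) \<partial>lborel \<partial>lborel)"
      by (subst lborel_pair.nn_integral_snd[symmetric]) (auto simp del: lborel_pair.nn_integral_snd)
    also have "\<dots> = (\<integral>\<^sup>+l. \<integral>\<^sup>+a. g l * indicator {0<..} l * (if s + a \<le> s \<and> s \<le> s + a + l then 1 else 0)
            * indicator E (s, s + a - s, l) \<partial>lborel \<partial>lborel)"
      by (rule nn_integral_cong, subst nn_integral_real_affine[where c = 1 and t = s]) auto
    also have "\<dots> = (\<integral>\<^sup>+l. \<integral>\<^sup>+a. g l * indicator ?R (a, l) * indicator E (s, a, l) \<partial>lborel \<partial>lborel)"
    proof (rule nn_integral_cong_AE)
      \<comment> \<open>\<open>latent_density\<close> excludes zero length while \<open>?R\<close>
        does not; the difference is a null set. For negative lengths \<open>?R\<close> is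
        empty.\<close>
      have "AE l in lborel. l \<noteq> (0::real)" by (rule AE_lborel_singleton)
      then show "AE l in lborel. (\<integral>\<^sup>+a. g l * indicator {0<..} l * (if s + a \<le> s \<and> s \<le> s + a + l then 1 else 0)
            * indicator E (s, s + a - s, l) \<partial>lborel) = (\<integral>\<^sup>+a. g l * indicator ?R (a, l) * indicator E (s, a, l) \<partial>lborel)"
        by eventually_elim (intro nn_integral_cong, auto simp: indicator_def)
    qed
    also have "\<dots> = (\<integral>\<^sup>+x. g (snd x) * indicator ?R x * indicator E (s, x) \<partial>(lborel \<Otimes>\<^sub>M lborel))"
      by (subst lborel_pair.nn_integral_snd[symmetric]) auto
    finally show "(\<integral>\<^sup>+x. ?F (False, x) s \<partial>(lborel \<Otimes>\<^sub>M lborel))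
        = (\<integral>\<^sup>+x. g (snd x) * indicator ?R x * indicator E (s, x) \<partial>(lborel \<Otimes>\<^sub>M lborel))" .
  qed
  also have "(\<integral>\<^sup>+t. c * indicator E (t, 0, 0) \<partial>?LS) + \<dots>
      = (\<integral>\<^sup>+t. c * indicator E (t, 0, 0) + (\<integral>\<^sup>+x. g (snd x) * indicator ?R x * indicator E (t, x) \<partial>(lborel \<Otimes>\<^sub>M lborel)) \<partial>?LS)"
    by (rule nn_integral_add[symmetric]) measurable
  also have "\<dots> = (\<integral>\<^sup>+t. emeasure \<nu> (Pair t -` E) \<partial>?LS)"
  proof (intro nn_integral_cong)
    fix t
    have "Pair t -` E \<in> sets \<nu>" using E by (rule sets_Pair1)
    from em[OF this]
    show "c * indicator E (t, 0, 0) + (\<integral>\<^sup>+x. g (snd x) * indicator ?R x * indicator E (t, x) \<partial>(lborel \<Otimes>\<^sub>M lborel)) = emeasure \<nu> (Pair t -` E)"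
      by (simp add: indicator_def)
  qed
  also have "\<dots> = emeasure (?LS \<Otimes>\<^sub>M \<nu>) E"
    using E by (rule \<nu>.emeasure_pair_measure_alt[symmetric])
  finally show ?thesis by simp
qed

section \<open>The unnormalised posterior of a labelled observation\<close>

definition location_set :: "real set \<Rightarrow> nat \<Rightarrow> (nat \<Rightarrow> real \<times> real) \<Rightarrow> (nat \<Rightarrow> real) \<Rightarrow> real set" where
  "location_set S n v s = (\<lambda>i. location S (v i) (s i)) ` {1..n}"

text \<open>This is the numerator of the posterior for one labelling, without the sum over
  permutations. All \<open>n\<close> locations are integrated, the dummies of the atoms included, so
  that the reference measure does not depend on the number of atoms.\<close>

definition window_integral :: "real set \<Rightarrow> (real set \<Rightarrow> real) \<Rightarrow> nat \<Rightarrow> (nat \<Rightarrow> real \<times> real) \<Rightarrow> real set set \<Rightarrow> ennreal" where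
  "window_integral S p n v A =
     (\<integral>\<^sup>+s. (\<Prod>i\<in>{1..n}. window S (v i) (s i)) *
        (ennreal (p (location_set S n v s)) * indicator A (location_set S n v s))
        \<partial>(\<Pi>\<^sub>M i\<in>{1..n}. restrict_space lborel S))"

lemma measurable_window_component:
  assumes f: "f \<in> measurable N (borel \<Otimes>\<^sub>M borel)" and g: "g \<in> borel_measurable N"
  shows "(\<lambda>x. window S (f x) (g x)) \<in> borel_measurable N"
  using measurable_compose[OF measurable_Pair[OF f g] measurable_window] by simp

lemma measurable_location_component:
  assumes f: "f \<in> measurable N (borel \<Otimes>\<^sub>M borel)" and g: "g \<in> borel_measurable N" and S: "S \<in> sets borel"
  shows "(\<lambda>x. location S (f x) (g x)) \<in> borel_measurable N"
  using measurable_compose[OF measurable_Pair[OF f g] measurable_location[OF S]] by simp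

lemma measurable_restrict_lborel_component:
  assumes "i \<in> I"
  shows "(\<lambda>s. s i) \<in> borel_measurable (PiM I (\<lambda>_. restrict_space lborel S))"
  using measurable_component_singleton[OF assms] measurable_id_restrict_lborel by (rule measurable_compose)

lemma window_integrand_measurable:
  assumes f: "\<And>i. i \<in> {1..n} \<Longrightarrow> (\<lambda>x. f x i) \<in> measurable N (borel \<Otimes>\<^sub>M borel)"
    and g: "g \<in> measurable N (\<Pi>\<^sub>M i\<in>{1..n}. restrict_space lborel S)"
    and S: "S \<in> sets borel"
    and p [measurable]: "p \<in> borel_measurable (weak_borel S)" and A [measurable]: "A \<in> sets (weak_borel S)"
  shows "(\<lambda>x. (\<Prod>i\<in>{1..n}. window S (f x i) (g x i)) *
        (ennreal (p (location_set S n (f x) (g x))) * indicator A (location_set S n (f x) (g x)))) \<in> borel_measurable N"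
proof -
  have gi: "(\<lambda>x. g x i) \<in> borel_measurable N" if "i \<in> {1..n}" for i
    using g measurable_restrict_lborel_component[OF that] by (rule measurable_compose)
  have "g x i \<in> S" if "i \<in> {1..n}" "x \<in> space N" for x i
    using measurable_space[OF g that(2)] that(1) by (auto simp: space_PiM space_restrict_space)
  then have [measurable]: "(\<lambda>x. location_set S n (f x) (g x)) \<in> measurable N (weak_borel S)"
    unfolding location_set_def using f gi S
    by (intro measurable_image_config measurable_location_component) (auto simp: location_def)
  have [measurable]: "(\<lambda>x. \<Prod>i\<in>{1..n}. window S (f x i) (g x i)) \<in> borel_measurable N"
    using f gi by (intro borel_measurable_prod_ennreal measurable_window_component)
  show ?thesis by measurable
qed

text \<open>A product of equal factors is invariant under permutations of the coordinates. This is
  \<open>nn_integral_PiM_coordinates\<close> for equal index sets, where the normalising power is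
  trivial.\<close>

lemma window_integral_reindex:
  assumes S: "S \<in> sets borel" "emeasure lborel S < \<infinity>"
    and p: "p \<in> borel_measurable (weak_borel S)" and A: "A \<in> sets (weak_borel S)"
    and \<sigma>: "bij_betw \<sigma> {1..n} {1..n}" and w: "\<And>i. i \<in> {1..n} \<Longrightarrow> w i = v (\<sigma> i)"
  shows "window_integral S p n w A = window_integral S p n v A"
proof -
  let ?P = "\<Pi>\<^sub>M i\<in>{1..n}. restrict_space lborel S"
  let ?f = "\<lambda>s. (\<Prod>i\<in>{1..n}. window S (w i) (s i)) *
        (ennreal (p (location_set S n w s)) * indicator A (location_set S n w s))"
  have "window_integral S p n w A = (\<integral>\<^sup>+s. inverse (emeasure (restrict_space lborel S) (space (restrict_space lborel S))) ^ (card {1..n} - card {1..n}) *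
      ?f (\<lambda>j\<in>{1..n}. s (\<sigma> j)) \<partial>?P)"
    unfolding window_integral_def
  proof (rule nn_integral_PiM_coordinates[OF finite_measure_restrict_lborel[OF S]])
    show "?f \<in> borel_measurable ?P"
      by (rule window_integrand_measurable[OF _ _ S(1) p A]) (auto intro!: measurable_const simp: space_pair_measure)
  qed (use \<sigma> in \<open>auto simp: bij_betw_def\<close>)
  also have "\<dots> = window_integral S p n v A"
    unfolding window_integral_def
  proof (intro nn_integral_cong)
    fix s
    have "location_set S n w (\<lambda>j\<in>{1..n}. s (\<sigma> j)) = (\<lambda>i. location S (v i) (s i)) ` \<sigma> ` {1..n}"
      by (simp add: location_set_def image_image w)
    also have "\<dots> = location_set S n v s"
      using \<sigma> by (simp add: location_set_def bij_betw_def)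
    finally have 1: "location_set S n w (\<lambda>j\<in>{1..n}. s (\<sigma> j)) = location_set S n v s" .
    have "(\<Prod>i\<in>{1..n}. window S (w i) ((\<lambda>j\<in>{1..n}. s (\<sigma> j)) i)) = (\<Prod>i\<in>{1..n}. window S (v (\<sigma> i)) (s (\<sigma> i)))"
      by (intro prod.cong) (auto simp: w)
    also have "\<dots> = (\<Prod>i\<in>{1..n}. window S (v i) (s i))"
      by (rule prod.reindex_bij_betw[OF \<sigma>])
    finally show "inverse (emeasure (restrict_space lborel S) (space (restrict_space lborel S))) ^ (card {1..n} - card {1..n}) *
      ?f (\<lambda>j\<in>{1..n}. s (\<sigma> j)) = (\<Prod>i\<in>{1..n}. window S (v i) (s i)) *
        (ennreal (p (location_set S n v s)) * indicator A (location_set S n v s))"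
      using 1 by simp
  qed
  finally show ?thesis .
qed

text \<open>Two enumerations of one set differ by a permutation, so the integral depends on the
  observed set only.\<close>

lemma window_integral_cong_image:
  assumes S: "S \<in> sets borel" "emeasure lborel S < \<infinity>"
    and p: "p \<in> borel_measurable (weak_borel S)" and A: "A \<in> sets (weak_borel S)"
    and "inj_on v {1..n}" "inj_on w {1..n}" "v ` {1..n} = w ` {1..n}"
  shows "window_integral S p n w A = window_integral S p n v A"
proof (rule window_integral_reindex[OF S p A])
  let ?\<sigma> = "\<lambda>i. the_inv_into {1..n} v (w i)"
  show "bij_betw ?\<sigma> {1..n} {1..n}"
    using bij_betw_trans[OF inj_on_imp_bij_betw[OF assms(6)] bij_betw_the_inv_into[OF inj_on_imp_bij_betw[OF assms(5)], unfolded assms(7)]]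
    by (simp add: comp_def)
  show "w i = v (?\<sigma> i)" if "i \<in> {1..n}" for i
    using f_the_inv_into_f[OF assms(5), of "w i"] assms(7) that by auto
qed

text \<open>The integral over the locations is symmetric, so that every permutation in
  the sum over matchings contributes equally.\<close>

lemma nn_integral_matchings:
  fixes S :: "real set"
  assumes S: "open S" "emeasure lborel S < \<infinity>"
    and p: "p \<in> borel_measurable (weak_borel S)" and A: "A \<in> sets (weak_borel S)"
    and en: "enumerates S u m n a l"
  shows "(\<integral>\<^sup>+x. ennreal (p (a ` {1..m} \<union> x ` {1..n-m})) * indicator A (a ` {1..m} \<union> x ` {1..n-m})
          * matchings m n a l x \<partial>(\<Pi>\<^sub>M i\<in>{1..n-m}. restrict_space lborel S)) =
         fact (n - m) * window_integral S p n (\<lambda>i. (a i, l i)) A"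
proof -
  let ?J = "{1..n-m}" and ?I = "{1..n}" and ?LS = "restrict_space lborel S"
  let ?P = "PiM ?J (\<lambda>_. ?LS)"
  have Sb: "S \<in> sets borel" using S by simp
  have mn: "m \<le> n" and aS: "\<And>i. i \<in> {1..m} \<Longrightarrow> a i \<in> S \<and> l i = 0" and lpos: "\<And>i. i \<in> {m+1..n} \<Longrightarrow> 0 < l i"
    using en by (auto simp: enumerates_def)
  have em: "emeasure ?LS (space ?LS) = emeasure lborel S"
    using Sb by (simp add: emeasure_restrict_space space_restrict_space)
  define X where "X x = a ` {1..m} \<union> x ` ?J" for x
  define G where "G x = ennreal (p (X x)) * indicator A (X x)" for x
  \<comment> \<open>Known and integrated locations are put under one index set so that
    \<open>measurable_image_config\<close> applies.\<close>
  have X_eq: "X x = (\<lambda>i. if i \<le> m then a i else x (i - m)) ` ?I" for x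
  proof -
    have "?I = {1..m} \<union> (\<lambda>j. j + m) ` ?J"
      using mn by (auto simp: image_iff Bex_def intro: exI[of _ "_ - m"])
    then have "(\<lambda>i. if i \<le> m then a i else x (i - m)) ` ?I
        = (\<lambda>i. if i \<le> m then a i else x (i - m)) ` {1..m} \<union> (\<lambda>i. if i \<le> m then a i else x (i - m)) ` (\<lambda>j. j + m) ` ?J"
      by (simp only: image_Un)
    also have "(\<lambda>i. if i \<le> m then a i else x (i - m)) ` {1..m} = a ` {1..m}"
      by (intro image_cong) auto
    also have "(\<lambda>i. if i \<le> m then a i else x (i - m)) ` (\<lambda>j. j + m) ` ?J = x ` ?J"
      unfolding image_image by (intro image_cong) auto
    finally show ?thesis by (simp only: X_def)
  qed
  have X [measurable]: "X \<in> measurable ?P (weak_borel S)"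
    unfolding X_eq[abs_def]
  proof (rule measurable_image_config)
    fix i assume i: "i \<in> ?I"
    show "(\<lambda>x. if i \<le> m then a i else x (i - m)) \<in> borel_measurable ?P"
    proof (cases "i \<le> m")
      case False
      then have "i - m \<in> ?J" using i by auto
      from measurable_restrict_lborel_component[OF this] show ?thesis using False by simp
    qed simp
    show "(if i \<le> m then a i else x (i - m)) \<in> S" if "x \<in> space ?P" for x
    proof (cases "i \<le> m")
      case False
      then have "i - m \<in> ?J" using i by auto
      then show ?thesis using False that by (auto simp: space_PiM space_restrict_space PiE_iff)
    qed (use i aS in auto)
  qed simp
  have G [measurable]: "G \<in> borel_measurable ?P"
    using p A unfolding G_def by measurable
  define f where "f D x = G x * (\<Prod>i=1..n-m. indicator {a (m+i)..a (m+i) + l (m+i)} (x (D i)))" for D x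
  have f: "f D \<in> borel_measurable ?P" if D: "D permutes ?J" for D
  proof -
    have "(\<lambda>x. indicator {a (m+i)..a (m+i) + l (m+i)} (x (D i)) :: ennreal) \<in> borel_measurable ?P"
      if i: "i \<in> ?J" for i
    proof -
      have "D i \<in> ?J" using D i by (simp only: permutes_in_image)
      from measurable_restrict_lborel_component[OF this]
      show ?thesis by (rule measurable_compose) simp
    qed
    then show ?thesis
      unfolding f_def[abs_def] by (intro borel_measurable_times_ennreal G borel_measurable_prod_ennreal)
  qed
  have int_f: "(\<integral>\<^sup>+x. f D x \<partial>?P) = window_integral S p n (\<lambda>i. (a i, l i)) A" if D: "D permutes ?J" for D
  proof -
    \<comment> \<open>This choice gives \<open>x (D i) = s (m + i)\<close>: undoing \<open>D\<close>
      aligns each location with its own window, and the coordinates up to \<open>m\<close> stay free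
      for the atoms.\<close>
    define \<pi> where "\<pi> j = m + inv D j" for j
    have D': "inv D permutes ?J" using D by (rule permutes_inv)
    have "(\<integral>\<^sup>+x. f D x \<partial>?P) = (\<integral>\<^sup>+s. inverse (emeasure ?LS (space ?LS)) ^ (card ?I - card ?J) * f D (\<lambda>j\<in>?J. s (\<pi> j)) \<partial>PiM ?I (\<lambda>_. ?LS))"
    proof (rule nn_integral_PiM_coordinates[OF finite_measure_restrict_lborel[OF Sb S(2)]])
      show "inj_on \<pi> ?J" using permutes_inj[OF D'] by (auto simp: \<pi>_def inj_on_def)
      show "\<pi> ` ?J \<subseteq> ?I"
      proof clarify
        fix j assume "j \<in> ?J"
        then have "inv D j \<in> ?J" using D' by (simp only: permutes_in_image)
        then show "\<pi> j \<in> ?I" using mn by (auto simp: \<pi>_def)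
      qed
      \<comment> \<open>The strict inequality means \<open>m > 0\<close>, so the atom
        \<open>a 1\<close> witnesses that \<open>S\<close> is nonempty.\<close>
      show "emeasure ?LS (space ?LS) \<noteq> 0" if "card ?J < card ?I"
        unfolding em using that aS[of 1] mn by (intro open_emeasure_pos[OF S(1), of "a 1"]) auto
      show "f D \<in> borel_measurable ?P" by (rule f[OF D])
    qed auto
    also have "\<dots> = window_integral S p n (\<lambda>i. (a i, l i)) A"
      unfolding window_integral_def
    proof (intro nn_integral_cong)
      fix s :: "nat \<Rightarrow> real"
      let ?x = "\<lambda>j\<in>?J. s (\<pi> j)"
      have xD: "?x (D i) = s (m + i)" if "i \<in> ?J" for i
      proof -
        have "D i \<in> ?J" using D that by (simp only: permutes_in_image)
        then show ?thesis using permutes_inverses(2)[OF D] by (simp add: \<pi>_def)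
      qed
      have split: "?I = {1..m} \<union> (\<lambda>i. m + i) ` ?J"
        using mn by (auto simp: image_iff Bex_def intro: exI[of _ "_ - m"])
      have "?x ` ?J = ?x ` D ` ?J" using D by (simp only: permutes_image)
      also have "\<dots> = (\<lambda>i. s (m + i)) ` ?J" unfolding image_image using xD by (intro image_cong) auto
      also have "\<dots> = (\<lambda>i. location S (a i, l i) (s i)) ` (\<lambda>i. m + i) ` ?J"
        unfolding image_image using lpos[of "m + _"] mn by (intro image_cong) (force simp: location_def)+
      finally have XJ: "?x ` ?J = (\<lambda>i. location S (a i, l i) (s i)) ` (\<lambda>i. m + i) ` ?J" .
      have "a ` {1..m} = (\<lambda>i. location S (a i, l i) (s i)) ` {1..m}"
        using aS by (intro image_cong) (auto simp: location_def)
      with XJ have Xs: "X ?x = location_set S n (\<lambda>i. (a i, l i)) s"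
        unfolding location_set_def by (subst split) (simp only: X_def image_Un)
      have "(\<Prod>i\<in>?I. window S (a i, l i) (s i))
          = (\<Prod>i\<in>{1..m}. window S (a i, l i) (s i)) * (\<Prod>i\<in>(\<lambda>i. m + i) ` ?J. window S (a i, l i) (s i))"
        by (subst split, rule prod.union_disjoint) auto
      also have "(\<Prod>i\<in>{1..m}. window S (a i, l i) (s i)) = (\<Prod>i\<in>{1..m}. inverse (emeasure lborel S))"
        using aS by (intro prod.cong) (auto simp: window_def)
      also have "(\<Prod>i\<in>(\<lambda>i. m + i) ` ?J. window S (a i, l i) (s i)) = (\<Prod>i\<in>?J. window S (a (m+i), l (m+i)) (s (m+i)))"
        by (subst prod.reindex) (auto simp: inj_on_def)
      also have "\<dots> = (\<Prod>i\<in>?J. indicator {a (m+i)..a (m+i) + l (m+i)} (?x (D i)))"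
      proof (intro prod.cong refl)
        fix i assume i: "i \<in> ?J"
        then have "0 < l (m + i)" using mn by (intro lpos) auto
        then show "window S (a (m+i), l (m+i)) (s (m+i)) = indicator {a (m+i)..a (m+i) + l (m+i)} (?x (D i))"
          unfolding xD[OF i] by (simp add: window_def)
      qed
      finally have W: "(\<Prod>i\<in>?I. window S (a i, l i) (s i))
        = inverse (emeasure lborel S) ^ m * (\<Prod>i\<in>?J. indicator {a (m+i)..a (m+i) + l (m+i)} (?x (D i)))" by simp
      \<comment> \<open>The \<open>m\<close> free coordinates contribute exactly the power of the
        inverse mass that the windows of the atoms carry.\<close>
      have "card ?I - card ?J = m" using mn by simp
      then show "inverse (emeasure ?LS (space ?LS)) ^ (card ?I - card ?J) * f D ?x =
        (\<Prod>i\<in>?I. window S (a i, l i) (s i)) *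
        (ennreal (p (location_set S n (\<lambda>i. (a i, l i)) s)) * indicator A (location_set S n (\<lambda>i. (a i, l i)) s))"
        unfolding em W f_def G_def Xs by (simp only: mult_ac)
    qed
    finally show ?thesis .
  qed
  have "(\<integral>\<^sup>+x. ennreal (p (a ` {1..m} \<union> x ` ?J)) * indicator A (a ` {1..m} \<union> x ` ?J) * matchings m n a l x \<partial>?P)
      = (\<integral>\<^sup>+x. (\<Sum>D | D permutes ?J. f D x) \<partial>?P)"
    unfolding matchings_def f_def G_def X_def sum_distrib_left ..
  also have "\<dots> = (\<Sum>D | D permutes ?J. \<integral>\<^sup>+x. f D x \<partial>?P)"
    using f by (intro nn_integral_sum) auto
  also have "\<dots> = (\<Sum>D | D permutes ?J. window_integral S p n (\<lambda>i. (a i, l i)) A)"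
    using int_f by (intro sum.cong) auto
  also have "\<dots> = fact (n - m) * window_integral S p n (\<lambda>i. (a i, l i)) A"
    by (simp add: card_permutations[OF refl])
  finally show ?thesis .
qed

section \<open>The posterior kernel\<close>

lemma c_inv_eq:
  assumes S: "open S" "emeasure lborel S < \<infinity>"
    and p: "p \<in> borel_measurable (weak_borel S)" and en: "enumerates S u m n a l"
  shows "c_inv S p m n a l = fact (n - m) * window_integral S p n (\<lambda>i. (a i, l i)) (configs S)"
proof -
  have "c_inv S p m n a l = (\<integral>\<^sup>+x. ennreal (p (a ` {1..m} \<union> x ` {1..n-m})) *
      indicator (configs S) (a ` {1..m} \<union> x ` {1..n-m})
          * matchings m n a l x \<partial>(\<Pi>\<^sub>M i\<in>{1..n-m}. restrict_space lborel S))"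
    unfolding c_inv_def
  proof (intro nn_integral_cong)
    fix x assume "x \<in> space (\<Pi>\<^sub>M i\<in>{1..n-m}. restrict_space lborel S)"
    then have "a ` {1..m} \<union> x ` {1..n-m} \<in> configs S"
      using en by (auto simp: space_PiM space_restrict_space configs_def enumerates_def)
    then show "ennreal (p (a ` {1..m} \<union> x ` {1..n-m})) * matchings m n a l x = ennreal (p (a ` {1..m} \<union> x ` {1..n-m})) *
      indicator (configs S) (a ` {1..m} \<union> x ` {1..n-m}) * matchings m n a l x" by simp
  qed
  also have "\<dots> = fact (n - m) * window_integral S p n (\<lambda>i. (a i, l i)) (configs S)"
    using sets.top[of "weak_borel S"] by (intro nn_integral_matchings[OF S p _ en]) simp
  finally show ?thesis .
qed

lemma fact_ennreal: "(fact k :: ennreal) \<noteq> 0" "(fact k :: ennreal) < top"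
proof -
  have "(fact k :: ennreal) = of_nat (fact k)" by (rule of_nat_fact[symmetric])
  then show "(fact k :: ennreal) \<noteq> 0" "(fact k :: ennreal) < top"
    by (simp_all only: of_nat_eq_0_iff fact_nonzero of_nat_less_top not_False_eq_True)
qed

section \<open>From labelled tuples to configurations\<close>

definition labelling :: "'a set \<Rightarrow> nat \<Rightarrow> 'a" where
  "labelling u = (SOME v. inj_on v {1..card u} \<and> v ` {1..card u} = u)"

lemma labelling:
  assumes "finite u"
  shows "inj_on (labelling u) {1..card u}" "labelling u ` {1..card u} = u"
proof -
  obtain v where "bij_betw v {1..card u} u"
    using ex_bij_betw_nat_finite_1[OF assms] by blast
  then have "\<exists>v. inj_on v {1..card u} \<and> v ` {1..card u} = u"
    by (auto simp: bij_betw_def)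
  from someI_ex[OF this] show "inj_on (labelling u) {1..card u}" "labelling u ` {1..card u} = u"
    by (simp_all add: labelling_def)
qed

text \<open>The choice behind \<open>labelling\<close> is immaterial by
  \<open>window_integral_cong_image\<close>, so this is the integral as a function of the observed
  set.\<close>

definition config_integral :: "real set \<Rightarrow> (real set \<Rightarrow> real) \<Rightarrow> (real \<times> real) set \<Rightarrow> real set set \<Rightarrow> ennreal" where
  "config_integral S p u A = window_integral S p (card u) (labelling u) A"

text \<open>Unlike \<open>posterior\<close>, which refers to an enumeration with the atoms first,
  this ratio is defined for every set, as a kernel must be. The factorial common to numerator and
  denominator is left out.\<close>

definition posterior_kernel :: "real set \<Rightarrow> (real set \<Rightarrow> real) \<Rightarrow> (real \<times> real) set \<Rightarrow> real set set \<Rightarrow> ennreal" where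
  "posterior_kernel S p u A = config_integral S p u A / config_integral S p u (configs S)"

lemma config_integral_image:
  assumes S: "S \<in> sets borel" "emeasure lborel S < \<infinity>"
    and p: "p \<in> borel_measurable (weak_borel S)" and A: "A \<in> sets (weak_borel S)"
    and w: "inj_on w {1..k}"
  shows "config_integral S p (w ` {1..k}) A = window_integral S p k w A"
proof -
  have fin: "finite (w ` {1..k})" by simp
  have c: "card (w ` {1..k}) = k" using w by (simp add: card_image)
  show ?thesis
    unfolding config_integral_def c
    by (rule window_integral_cong_image[OF S p A w labelling(1)[OF fin, unfolded c]
          labelling(2)[OF fin, unfolded c, symmetric]])
qed

lemma measurable_window_integral:
  assumes f: "\<And>i. i \<in> {1..n} \<Longrightarrow> (\<lambda>x. f x i) \<in> measurable N (borel \<Otimes>\<^sub>M borel)"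
    and S: "S \<in> sets borel" "emeasure lborel S < \<infinity>"
    and p: "p \<in> borel_measurable (weak_borel S)" and A: "A \<in> sets (weak_borel S)"
  shows "(\<lambda>x. window_integral S p n (f x) A) \<in> borel_measurable N"
proof -
  let ?LS = "restrict_space lborel S"
  interpret LS: finite_measure ?LS by (rule finite_measure_restrict_lborel[OF S])
  interpret P: product_sigma_finite "\<lambda>_ :: nat. ?LS"
    by (simp add: product_sigma_finite_def LS.sigma_finite_measure_axioms)
  interpret P: finite_product_sigma_finite "\<lambda>_ :: nat. ?LS" "{1..n}" by standard simp
  show ?thesis
    unfolding window_integral_def
  proof (rule P.borel_measurable_nn_integral)
    have "(\<lambda>x. f (fst x) i) \<in> measurable (N \<Otimes>\<^sub>M (\<Pi>\<^sub>M i\<in>{1..n}. ?LS)) (borel \<Otimes>\<^sub>M borel)" if "i \<in> {1..n}" for i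
      using measurable_fst f[OF that] by (rule measurable_compose)
    then show "(\<lambda>(x, s). (\<Prod>i\<in>{1..n}. window S (f x i) (s i)) *
        (ennreal (p (location_set S n (f x) s)) * indicator A (location_set S n (f x) s)))
        \<in> borel_measurable (N \<Otimes>\<^sub>M (\<Pi>\<^sub>M i\<in>{1..n}. ?LS))"
      unfolding case_prod_beta by (intro window_integrand_measurable measurable_snd S p A)
  qed
qed

lemma measurable_mark_component:
  assumes "i \<in> {1..k}"
  shows "(\<lambda>w. w i) \<in> measurable (\<Pi>\<^sub>M i\<in>{1..k}. restrict_space borel marks) (borel \<Otimes>\<^sub>M borel)"
  using measurable_component_singleton[OF assms]
  by (rule measurable_compose) (auto simp: borel_prod intro: measurable_restrict_space1)

text \<open>The chosen labelling need not depend measurably on the set; at the image of an injective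
  tuple it may be replaced by that tuple.\<close>

lemma measurable_config_integral:
  assumes S: "S \<in> sets borel" "emeasure lborel S < \<infinity>"
    and p: "p \<in> borel_measurable (weak_borel S)" and A: "A \<in> sets (weak_borel S)"
  shows "(\<lambda>u. config_integral S p u A) \<in> borel_measurable (weak_borel marks)"
proof (rule measurable_configI)
  show "(\<lambda>w. window_integral S p k w A) \<in> borel_measurable (\<Pi>\<^sub>M i\<in>{1..k}. restrict_space borel marks)" for k
    by (intro measurable_window_integral measurable_mark_component S p A)
  show "config_integral S p (w ` {1..k}) A = window_integral S p k w A" if "inj_on w {1..k}" for k w
    by (rule config_integral_image[OF S p A that])
qed

lemma posterior_kernel_eq_posterior:
  assumes S: "open S" "emeasure lborel S < \<infinity>"
    and p: "p \<in> borel_measurable (weak_borel S)" and A: "A \<in> sets (weak_borel S)"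
    and en: "enumerates S u m n a l"
  shows "posterior_kernel S p u A = posterior S p m n a l A"
proof -
  have Sb: "S \<in> sets borel" using S by simp
  have conf: "configs S \<in> sets (weak_borel S)" using sets.top[of "weak_borel S"] by simp
  let ?v = "\<lambda>i. (a i, l i)"
  have u: "u = ?v ` {1..n}" "inj_on ?v {1..n}" using en by (auto simp: enumerates_def)
  have "posterior_kernel S p u A = window_integral S p n ?v A / window_integral S p n ?v (configs S)"
    unfolding posterior_kernel_def u(1)
    by (simp only: config_integral_image[OF Sb S(2) p A u(2)] config_integral_image[OF Sb S(2) p conf u(2)])
  also have "\<dots> = window_integral S p n ?v A * fact (n - m) / (window_integral S p n ?v (configs S) * fact (n - m))"
    using fact_ennreal[of "n - m"] by (intro divide_mult_eq[symmetric]) auto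
  also have "\<dots> = posterior S p m n a l A"
    unfolding posterior_def c_inv_eq[OF S p en] nn_integral_matchings[OF S p A en]
    by (simp only: divide_ennreal_def mult_ac)
  finally show ?thesis .
qed

text \<open>A condition on the set alone that guarantees an enumeration with normalising constant in
  (0, \<infinity>). Without a quantifier over enumerations its measurability is accessible.\<close>

definition regular_config :: "real set \<Rightarrow> (real set \<Rightarrow> real) \<Rightarrow> (real \<times> real) set \<Rightarrow> bool" where
  "regular_config S p u \<longleftrightarrow> (\<forall>x\<in>u. snd x = 0 \<longrightarrow> fst x \<in> S) \<and>
     0 < config_integral S p u (configs S) \<and> config_integral S p u (configs S) < \<infinity>"

lemma regular_config_enumerates:
  assumes S: "open S" "emeasure lborel S < \<infinity>"
    and p: "p \<in> borel_measurable (weak_borel S)"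
    and u: "u \<in> configs marks" and reg: "regular_config S p u"
  shows "\<exists>m n a l. enumerates S u m n a l \<and> 0 < c_inv S p m n a l \<and> c_inv S p m n a l < \<infinity>"
proof -
  have Sb: "S \<in> sets borel" using S by simp
  have conf: "configs S \<in> sets (weak_borel S)" using sets.top[of "weak_borel S"] by simp
  have fin: "finite u" and um: "u \<subseteq> marks" using u by (auto simp: configs_def)
  obtain xs where xs: "set xs = {x\<in>u. snd x = 0}" "distinct xs"
    using finite_distinct_list[of "{x\<in>u. snd x = 0}"] fin by auto
  obtain ys where ys: "set ys = {x\<in>u. snd x \<noteq> 0}" "distinct ys"
    using finite_distinct_list[of "{x\<in>u. snd x \<noteq> 0}"] fin by auto
  \<comment> \<open>Atoms are listed first, as \<open>enumerates\<close> demands; the list starts at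
    0, the enumeration at 1.\<close>
  define v where "v i = (xs @ ys) ! (i - 1)" for i
  let ?m = "length xs" and ?n = "length (xs @ ys)"
  have dist: "distinct (xs @ ys)" using xs ys by auto
  have im: "v ` {1..?n} = u"
  proof -
    have "{1..?n} = Suc ` {..<?n}" by (simp add: image_Suc_lessThan)
    then have "v ` {1..?n} = set (xs @ ys)"
      by (simp only: image_image v_def) (auto simp: set_conv_nth simp del: set_append)
    also have "\<dots> = u" using xs(1) ys(1) by auto
    finally show ?thesis .
  qed
  have inj: "inj_on v {1..?n}"
    using dist by (auto simp: inj_on_def v_def nth_eq_iff_index_eq simp del: length_append)
  have vm: "v i \<in> set xs" if "i \<in> {1..?m}" for i
    using that by (auto simp: v_def nth_append)
  have vn: "v i \<in> set ys" if "i \<in> {?m+1..?n}" for i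
    using that by (auto simp: v_def nth_append)
  have v: "(\<lambda>i. (fst (v i), snd (v i))) = v" by simp
  have en: "enumerates S u ?m ?n (\<lambda>i. fst (v i)) (\<lambda>i. snd (v i))"
    unfolding enumerates_def v
  proof (intro conjI ballI)
    show "fst (v i) \<in> S" "snd (v i) = 0" if "i \<in> {1..?m}" for i
      using vm[OF that] xs(1) reg by (auto simp: regular_config_def)
    show "0 < snd (v i)" if "i \<in> {?m+1..?n}" for i
      using vn[OF that] ys(1) um by (force simp: marks_def)
  qed (use im inj in auto)
  have "c_inv S p ?m ?n (\<lambda>i. fst (v i)) (\<lambda>i. snd (v i)) = fact (?n - ?m) * config_integral S p u (configs S)"
    unfolding c_inv_eq[OF S p en] v config_integral_image[OF Sb S(2) p conf inj, symmetric] im ..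
  moreover have "0 < fact (?n - ?m) * config_integral S p u (configs S)"
    "fact (?n - ?m) * config_integral S p u (configs S) < \<infinity>"
    using reg fact_ennreal[of "?n - ?m"]
    by (simp_all add: regular_config_def ennreal_zero_less_mult_iff ennreal_mult_less_top zero_less_iff_neq_zero)
  ultimately show ?thesis using en by metis
qed

lemma measurable_regular_config:
  assumes S: "S \<in> sets borel" "emeasure lborel S < \<infinity>"
    and p: "p \<in> borel_measurable (weak_borel S)"
  shows "{u \<in> configs marks. regular_config S p u} \<in> sets (weak_borel marks)"
proof -
  have conf: "configs S \<in> sets (weak_borel S)" using sets.top[of "weak_borel S"] by simp
  have "(\<lambda>u. \<forall>x\<in>u. snd x = (0::real) \<longrightarrow> fst x \<in> S) \<in> measurable (weak_borel marks) (count_space UNIV)"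
  proof (rule measurable_configI)
    fix k :: nat
    show "(\<lambda>w. \<forall>i\<in>{1..k}. snd (w i) = (0::real) \<longrightarrow> fst (w i) \<in> S) \<in> measurable (\<Pi>\<^sub>M i\<in>{1..k}. restrict_space borel marks) (count_space UNIV)"
    proof (rule pred_intros_finite)
      fix i assume "i \<in> {1..k}"
      note [measurable] = measurable_mark_component[OF this] S(1)
      show "(\<lambda>w. snd (w i) = (0::real) \<longrightarrow> fst (w i) \<in> S) \<in> measurable (\<Pi>\<^sub>M i\<in>{1..k}. restrict_space borel marks) (count_space UNIV)"
        by measurable
    qed simp
  qed auto
  moreover note measurable_config_integral[OF S p conf]
  ultimately have "{u \<in> space (weak_borel marks). regular_config S p u} \<in> sets (weak_borel marks)"
    unfolding regular_config_def by measurable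
  then show ?thesis by simp
qed

text \<open>Under either flag the first coordinate is governed by Lebesgue measure, which has no
  atoms. Ties must be excluded because \<open>config_integral_image\<close> requires an injective
  tuple.\<close>

lemma AE_observation_inj:
  "AE y in (\<Pi>\<^sub>M i\<in>{1..k::nat}. latent_measure). inj_on (\<lambda>i. observation (y i)) {1..k}"
proof -
  let ?P = "\<Pi>\<^sub>M i\<in>{1..k}. latent_measure"
  interpret L: product_sigma_finite "\<lambda>_ :: nat. latent_measure"
    by (simp add: product_sigma_finite_def sigma_finite_latent_measure)
  have f [measurable]: "(\<lambda>z. fst (snd z)) \<in> borel_measurable latent_measure"
    unfolding latent_measure_def by measurable
  have null: "emeasure latent_measure {z. fst (snd z) = r} = 0" for r
  proof -
    have "{z :: bool \<times> real \<times> real. fst (snd z) = r} = UNIV \<times> ({r} \<times> UNIV)" by auto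
    then show ?thesis
      unfolding latent_measure_def
      by (simp add: lborel_pair.emeasure_pair_measure_Times lborel.emeasure_pair_measure_Times)
  qed
  have "AE y in ?P. fst (snd (y i)) \<noteq> fst (snd (y j))" if ij: "i \<in> {1..k}" "j \<in> {1..k}" "i \<noteq> j" for i j
  proof -
    have fi [measurable]: "(\<lambda>y. fst (snd (y i))) \<in> borel_measurable ?P" if "i \<in> {1..k}" for i
      using measurable_component_singleton[OF that] f by (rule measurable_compose)
    note [measurable] = fi[OF ij(1)] fi[OF ij(2)]
    have ins: "{1..k} = insert i ({1..k} - {i})" using ij by auto
    let ?B = "{y \<in> space ?P. fst (snd (y i)) = fst (snd (y j))}"
    have B [measurable]: "?B \<in> sets ?P" by measurable
    have "emeasure ?P ?B = (\<integral>\<^sup>+y. indicator ?B y \<partial>?P)"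
      by (rule nn_integral_indicator[OF B, symmetric])
    \<comment> \<open>Coordinate \<open>i\<close> is integrated with all others fixed, so that the
      event confines it to a null set of \<open>latent_measure\<close>.\<close>
    also have "\<dots> = (\<integral>\<^sup>+x. \<integral>\<^sup>+z. indicator ?B (x(i := z)) \<partial>latent_measure \<partial>(\<Pi>\<^sub>M i\<in>{1..k} - {i}. latent_measure))"
    proof -
      have "(indicator ?B :: _ \<Rightarrow> ennreal) \<in> borel_measurable (\<Pi>\<^sub>M i\<in>insert i ({1..k} - {i}). latent_measure)"
        using B unfolding ins[symmetric] by simp
      from L.product_nn_integral_insert[OF _ _ this] show ?thesis
        unfolding ins[symmetric] by simp
    qed
    also have "\<dots> \<le> (\<integral>\<^sup>+x. \<integral>\<^sup>+z. indicator {z. fst (snd z) = fst (snd (x j))} z \<partial>latent_measure \<partial>(\<Pi>\<^sub>M i\<in>{1..k} - {i}. latent_measure))"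
      using ij by (intro nn_integral_mono) (auto simp: indicator_def)
    also have "\<dots> = 0"
    proof -
      have "{z. fst (snd z) = r} \<in> sets latent_measure" for r
        using measurable_sets[OF f, of "{r}"] by (simp add: latent_measure_def space_pair_measure vimage_def)
      then show ?thesis by (simp add: null)
    qed
    finally have "emeasure ?P ?B = 0" by simp
    then show ?thesis using B by (subst AE_iff_measurable[OF B]) auto
  qed
  then have "AE y in ?P. \<forall>i\<in>{1..k}. \<forall>j\<in>{1..k}. i \<noteq> j \<longrightarrow> fst (snd (y i)) \<noteq> fst (snd (y j))"
    by (intro AE_finite_allI) auto
  then show ?thesis
    by eventually_elim (auto simp: inj_on_def observation_def)
qed

text \<open>\<open>\<Phi>\<close> and \<open>latent_density\<close> depend on the observations only
  and leave the inner integral over the locations; what remains there is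
  \<open>window_integral\<close>. This is the joint law of observation and ground process, split by
  the number of points.\<close>

lemma nn_integral_observation:
  fixes S :: "real set"
  assumes S: "open S" "emeasure lborel S < \<infinity>"
    and fin: "finite_measure \<nu>" and \<nu>: "sets \<nu> = sets (restrict_space borel marks)"
    and g: "g \<in> borel_measurable borel"
    and em: "\<And>B. B \<in> sets \<nu> \<Longrightarrow> emeasure \<nu> B = c * indicator B (0, 0) +
      (\<integral>\<^sup>+x. g (snd x) * indicator {(a, l). a \<le> 0 \<and> 0 \<le> a + l} x * indicator B x \<partial>(lborel \<Otimes>\<^sub>M lborel))"
    and p: "p \<in> borel_measurable (weak_borel S)" and A: "A \<in> sets (weak_borel S)"
    and \<Phi>: "\<Phi> \<in> borel_measurable (weak_borel marks)"
  shows "(\<integral>\<^sup>+w. ennreal (p (ground w)) * (\<Phi> (shifted w) * indicator A (ground w)) \<partial>marked_poisson S \<nu>) =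
    (\<Sum>k. ennreal (exp (- measure lborel S) / fact k) *
      (\<integral>\<^sup>+y. (\<Prod>i\<in>{1..k}. latent_density c g S (y i)) * \<Phi> ((\<lambda>i. observation (y i)) ` {1..k}) *
         window_integral S p k (\<lambda>i. observation (y i)) A \<partial>(\<Pi>\<^sub>M i\<in>{1..k}. latent_measure)))"
proof -
  let ?LS = "restrict_space lborel S"
  let ?h = "\<lambda>w. ennreal (p (ground w)) * (\<Phi> (shifted w) * indicator A (ground w))"
  have Sb [measurable]: "S \<in> sets borel" using S(1) by simp
  have h: "?h \<in> borel_measurable (weak_borel (S \<times> marks))"
    using measurable_ground[measurable] measurable_shifted[measurable] p[measurable] A[measurable] \<Phi>[measurable]
    by measurable
  interpret \<nu>: finite_measure \<nu> by fact
  interpret LS: finite_measure ?LS by (rule finite_measure_restrict_lborel[OF Sb S(2)])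
  interpret LN: pair_sigma_finite ?LS \<nu>
    by (intro pair_sigma_finite.intro LS.sigma_finite_measure_axioms \<nu>.sigma_finite_measure_axioms)
  have sp\<nu>: "space \<nu> = marks" using sets_eq_imp_space_eq[OF \<nu>] by (simp add: space_restrict_space)
  have obs: "(\<lambda>x. (observation (fst x), snd x)) \<in> measurable (latent_measure \<Otimes>\<^sub>M ?LS) ((borel \<Otimes>\<^sub>M borel) \<Otimes>\<^sub>M borel)"
    by measurable
  have [measurable]: "(\<lambda>x. window S (observation (fst x)) (snd x)) \<in> borel_measurable (latent_measure \<Otimes>\<^sub>M ?LS)"
    using measurable_compose[OF obs measurable_window] by simp
  have loc: "(\<lambda>x. location S (observation (fst x)) (snd x)) \<in> borel_measurable (latent_measure \<Otimes>\<^sub>M ?LS)"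
    using measurable_compose[OF obs measurable_location[OF Sb]] by simp
  have locS: "location S v s \<in> S" if "s \<in> S" for v s using that by (simp add: location_def)
  have obs_marks: "snd (observation y) \<ge> 0" for y by (simp add: observation_def)
  have \<Psi>: "(\<lambda>(y, s). marked_point S (observation y) s) \<in> measurable (latent_measure \<Otimes>\<^sub>M ?LS) (?LS \<Otimes>\<^sub>M \<nu>)"
    unfolding case_prod_beta marked_point_def
  proof (rule measurable_Pair)
    show "(\<lambda>x. location S (observation (fst x)) (snd x)) \<in> measurable (latent_measure \<Otimes>\<^sub>M ?LS) ?LS"
      using loc by (intro measurable_restrict_space2)
        (auto simp: space_pair_measure space_restrict_space locS)
    have "(\<lambda>x. (fst (observation (fst x)) - location S (observation (fst x)) (snd x), snd (observation (fst x))))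
        \<in> measurable (latent_measure \<Otimes>\<^sub>M ?LS) (borel \<Otimes>\<^sub>M borel)"
      using loc by measurable
    then show "(\<lambda>x. (fst (observation (fst x)) - location S (observation (fst x)) (snd x), snd (observation (fst x))))
        \<in> measurable (latent_measure \<Otimes>\<^sub>M ?LS) \<nu>"
      unfolding measurable_cong_sets[OF refl \<nu>] borel_prod
      by (intro measurable_restrict_space2) (auto simp: marks_def obs_marks)
  qed
  have \<omega>: "(\<lambda>(y, s). latent_density c g S y * window S (observation y) s) \<in> borel_measurable (latent_measure \<Otimes>\<^sub>M ?LS)"
    using g unfolding case_prod_beta by measurable
  have "(\<integral>\<^sup>+w. ?h w \<partial>marked_poisson S \<nu>) = (\<Sum>k. ennreal (exp (- measure lborel S) / fact k) *
          (\<integral>\<^sup>+w. ?h (w ` {1..k}) \<partial>(\<Pi>\<^sub>M i\<in>{1..k}. ?LS \<Otimes>\<^sub>M \<nu>)))"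
    by (rule nn_integral_marked_poisson[OF \<nu> h])
  moreover have "(\<integral>\<^sup>+w. ?h (w ` {1..k}) \<partial>(\<Pi>\<^sub>M i\<in>{1..k}. ?LS \<Otimes>\<^sub>M \<nu>)) =
      (\<integral>\<^sup>+y. (\<Prod>i\<in>{1..k}. latent_density c g S (y i)) * \<Phi> ((\<lambda>i. observation (y i)) ` {1..k}) *
         window_integral S p k (\<lambda>i. observation (y i)) A \<partial>(\<Pi>\<^sub>M i\<in>{1..k}. latent_measure))" for k :: nat
  proof -
    let ?L = "\<Pi>\<^sub>M i\<in>{1..k}. latent_measure" and ?P = "\<Pi>\<^sub>M i\<in>{1..k}. ?LS"
    have "(\<integral>\<^sup>+w. ?h (w ` {1..k}) \<partial>(\<Pi>\<^sub>M i\<in>{1..k}. ?LS \<Otimes>\<^sub>M \<nu>)) =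
        (\<integral>\<^sup>+y. \<integral>\<^sup>+s. (\<Prod>i\<in>{1..k}. latent_density c g S (y i) * window S (observation (y i)) (s i)) *
          ?h ((\<lambda>i\<in>{1..k}. marked_point S (observation (y i)) (s i)) ` {1..k}) \<partial>?P \<partial>?L)"
    proof (rule nn_integral_PiM_representation[OF sigma_finite_latent_measure LS.sigma_finite_measure_axioms
          LN.sigma_finite_measure_axioms _ \<omega> \<Psi> emeasure_location_mark[OF S fin \<nu> g em]])
      show "(\<lambda>w. ?h (w ` {1..k})) \<in> borel_measurable (\<Pi>\<^sub>M i\<in>{1..k}. ?LS \<Otimes>\<^sub>M \<nu>)"
        using measurable_tuple_config[OF \<nu>] h by (rule measurable_compose)
    qed auto
    also have "\<dots> = (\<integral>\<^sup>+y. (\<Prod>i\<in>{1..k}. latent_density c g S (y i)) * \<Phi> ((\<lambda>i. observation (y i)) ` {1..k}) *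
         window_integral S p k (\<lambda>i. observation (y i)) A \<partial>?L)"
    proof (rule nn_integral_cong)
      fix y :: "nat \<Rightarrow> bool \<times> real \<times> real"
      let ?v = "\<lambda>i. observation (y i)"
      let ?f = "\<lambda>s. (\<Prod>i\<in>{1..k}. window S (?v i) (s i)) *
        (ennreal (p (location_set S k ?v s)) * indicator A (location_set S k ?v s))"
      have f: "?f \<in> borel_measurable ?P"
        by (rule window_integrand_measurable[OF _ _ Sb p A]) (auto intro!: measurable_const simp: space_pair_measure)
      have "(\<integral>\<^sup>+s. (\<Prod>i\<in>{1..k}. latent_density c g S (y i) * window S (?v i) (s i)) *
          ?h ((\<lambda>i\<in>{1..k}. marked_point S (?v i) (s i)) ` {1..k}) \<partial>?P)
          = (\<integral>\<^sup>+s. ((\<Prod>i\<in>{1..k}. latent_density c g S (y i)) * \<Phi> (?v ` {1..k})) * ?f s \<partial>?P)"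
      proof (rule nn_integral_cong)
        fix s :: "nat \<Rightarrow> real"
        let ?w = "(\<lambda>i\<in>{1..k}. marked_point S (?v i) (s i)) ` {1..k}"
        have 1: "ground ?w = location_set S k ?v s"
          by (simp add: ground_def location_set_def image_image marked_point_def)
        have 2: "shifted ?w = ?v ` {1..k}"
          unfolding shifted_eq_image image_image by (intro image_cong) (auto simp: marked_point_def)
        show "(\<Prod>i\<in>{1..k}. latent_density c g S (y i) * window S (?v i) (s i)) * ?h ?w
            = ((\<Prod>i\<in>{1..k}. latent_density c g S (y i)) * \<Phi> (?v ` {1..k})) * ?f s"
          unfolding 1 2 prod.distrib by (simp only: mult_ac)
      qed
      also have "\<dots> = (\<Prod>i\<in>{1..k}. latent_density c g S (y i)) * \<Phi> (?v ` {1..k}) * window_integral S p k ?v A"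
        unfolding window_integral_def by (rule nn_integral_cmult[OF f])
      finally show "(\<integral>\<^sup>+s. (\<Prod>i\<in>{1..k}. latent_density c g S (y i) * window S (?v i) (s i)) *
          ?h ((\<lambda>i\<in>{1..k}. marked_point S (?v i) (s i)) ` {1..k}) \<partial>?P)
          = (\<Prod>i\<in>{1..k}. latent_density c g S (y i)) * \<Phi> (?v ` {1..k}) * window_integral S p k ?v A" .
    qed
    finally show ?thesis .
  qed
  ultimately show ?thesis by (simp only:)
qed

lemma window_integral_mono:
  assumes "A \<subseteq> B" shows "window_integral S p n v A \<le> window_integral S p n v B"
  unfolding window_integral_def using assms
  by (intro nn_integral_mono mult_left_mono) (auto simp: indicator_def)

lemma measurable_posterior_kernel:
  assumes S: "S \<in> sets borel" "emeasure lborel S < \<infinity>"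
    and p: "p \<in> borel_measurable (weak_borel S)" and A: "A \<in> sets (weak_borel S)"
  shows "(\<lambda>u. posterior_kernel S p u A) \<in> borel_measurable (weak_borel marks)"
proof -
  have "configs S \<in> sets (weak_borel S)" using sets.top[of "weak_borel S"] by simp
  note [measurable] = measurable_config_integral[OF S p A] measurable_config_integral[OF S p this]
  show ?thesis unfolding posterior_kernel_def divide_ennreal_def by measurable
qed

section \<open>The posterior as a conditional distribution\<close>

theorem theorem3p1:
  fixes R :: "'r measure" and Y Z :: "nat \<Rightarrow> 'r \<Rightarrow> real"
    and fYZ :: "real \<times> real \<Rightarrow> ennreal" and fY :: "real \<Rightarrow> ennreal"
    and S :: "real set" and p :: "real set \<Rightarrow> real"
    and M :: "'w measure" and W :: "'w \<Rightarrow> (real \<times> real \<times> real) set"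
  assumes R: "prob_space R"
    and iid_indep: "prob_space.indep_vars R (\<lambda>_. borel) (\<lambda>i \<omega>. (Y i \<omega>, Z i \<omega>)) UNIV"
    and iid_density: "\<And>i. distributed R lborel (\<lambda>\<omega>. (Y i \<omega>, Z i \<omega>)) fYZ"
    and density_support: "\<And>y z. (y, z) \<notin> {0..} \<times> {0..} \<Longrightarrow> fYZ (y, z) = 0"
    and T_integrable: "integrable R (\<lambda>\<omega>. Y 1 \<omega> + Z 1 \<omega>)"
    and T_pos: "0 < (\<integral>\<omega>. Y 1 \<omega> + Z 1 \<omega> \<partial>R)"
    and Y_density: "distributed R lborel (Y 1) fY"
    and S_open: "open S" and S_finite: "emeasure lborel S < \<infinity>"
    and p_measurable: "p \<in> borel_measurable (weak_borel S)"
    and p_nonneg: "\<And>x. x \<in> configs S \<Longrightarrow> 0 \<le> p x"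
    and M: "prob_space M"
    and W_density: "distributed M (marked_poisson S (mark_law R (Y 1) (Z 1) fY)) W
                      (\<lambda>w. ennreal (p (ground w)))"
  shows "(AE \<omega> in M. \<exists>m n a l. enumerates S (shifted (W \<omega>)) m n a l \<and>
             0 < c_inv S p m n a l \<and> c_inv S p m n a l < \<infinity>) \<and>
         (\<exists>\<kappa> :: (real \<times> real) set \<Rightarrow> real set set \<Rightarrow> ennreal.
            (\<forall>u m n a l. enumerates S u m n a l \<and>
               0 < c_inv S p m n a l \<and> c_inv S p m n a l < \<infinity> \<longrightarrow>
               (\<forall>A\<in>sets (weak_borel S). \<kappa> u A = posterior S p m n a l A)) \<and>
            (\<forall>A\<in>sets (weak_borel S).
               (\<lambda>u. \<kappa> u A) \<in> borel_measurable (weak_borel marks) \<and>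
               (\<forall>F\<in>sets (weak_borel marks).
                  (\<integral>\<^sup>+\<omega>. indicator F (shifted (W \<omega>)) * \<kappa> (shifted (W \<omega>)) A \<partial>M) =
                  (\<integral>\<^sup>+\<omega>. indicator F (shifted (W \<omega>)) * indicator A (ground (W \<omega>)) \<partial>M))))"
proof -
  interpret M: prob_space M by fact
  define \<nu> where "\<nu> = mark_law R (Y 1) (Z 1) fY"
  define EY ET where "EY = (\<integral>\<omega>. Y 1 \<omega> \<partial>R)" and "ET = (\<integral>\<omega>. Y 1 \<omega> + Z 1 \<omega> \<partial>R)"
  define c where "c = ennreal ((\<integral>\<omega>. Z 1 \<omega> \<partial>R) / ET)"
  \<comment> \<open>Formally \<open>fY l / ET\<close>; keeping the factors apart avoids a case
    distinction on \<open>EY\<close>.\<close>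
  define g where "g l = ennreal (EY / ET) * (fY l / ennreal EY)" for l
  have fY [measurable]: "fY \<in> borel_measurable borel" using Y_density by (auto simp: distributed_def)
  have g [measurable]: "g \<in> borel_measurable borel" unfolding g_def divide_ennreal_def by measurable
  have sets_\<nu>: "sets \<nu> = sets (restrict_space borel marks)" by (simp add: \<nu>_def)
  have fin_\<nu>: "finite_measure \<nu>"
    unfolding \<nu>_def using Y_density T_pos by (rule finite_measure_mark_law)
  have em: "emeasure \<nu> B = c * indicator B (0, 0) +
      (\<integral>\<^sup>+x. g (snd x) * indicator {(a, l). a \<le> 0 \<and> 0 \<le> a + l} x * indicator B x \<partial>(lborel \<Otimes>\<^sub>M lborel))"
    if B: "B \<in> sets \<nu>" for B
  proof -
    have Bb [measurable]: "B \<in> sets borel"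
      using B unfolding sets_\<nu> by (simp add: sets_restrict_space_iff marks_borel)
    have [measurable]: "(\<lambda>x :: real \<times> real. fY (snd x) / ennreal EY) \<in> borel_measurable borel"
      unfolding borel_prod[symmetric] divide_ennreal_def by measurable
    have "emeasure \<nu> B = c * indicator B (0, 0) + ennreal (EY / ET) * (\<integral>\<^sup>+x. fY (snd x) / ennreal EY *
        indicator {(a, l). a \<le> 0 \<and> 0 \<le> a + l} x * indicator B x \<partial>lborel)"
      using emeasure_mark_law[OF fY B[unfolded sets_\<nu>], of R "Y 1" "Z 1"]
      unfolding \<nu>_def c_def EY_def ET_def case_prod_beta by simp
    also have "\<dots> = c * indicator B (0, 0) + (\<integral>\<^sup>+x. ennreal (EY / ET) * (fY (snd x) / ennreal EY *
        indicator {(a, l). a \<le> 0 \<and> 0 \<le> a + l} x * indicator B x) \<partial>lborel)"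
      by (subst nn_integral_cmult) auto
    finally show ?thesis by (simp add: g_def lborel_prod mult.assoc)
  qed
  have Sb: "S \<in> sets borel" using S_open by simp
  have conf: "configs S \<in> sets (weak_borel S)" using sets.top[of "weak_borel S"] by simp
  have WX: "W \<in> measurable M (weak_borel (S \<times> marks))"
    using W_density unfolding distributed_def by (simp cong: measurable_cong_sets)
  have ground_conf: "ground (W \<omega>) \<in> configs S" and shifted_conf: "shifted (W \<omega>) \<in> configs marks"
    if "\<omega> \<in> space M" for \<omega>
    using measurable_space[OF WX that] measurable_space[OF measurable_ground, of _ S]
      measurable_space[OF measurable_shifted, of _ S] by auto

  define ck where "ck k = ennreal (exp (- measure lborel S) / fact k)" for k :: nat
  define L where "L k = (\<Pi>\<^sub>M i\<in>{1..k}. latent_measure)" for k :: nat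
  define d where "d k y = (\<Prod>i\<in>{1..k}. latent_density c g S (y i))" for k :: nat and y
  define v where "v y i = observation (y i)" for y :: "nat \<Rightarrow> bool \<times> real \<times> real" and i
  have vm: "(\<lambda>y. v y i) \<in> measurable (L k) (borel \<Otimes>\<^sub>M borel)" if "i \<in> {1..k}" for i k
    unfolding v_def L_def using measurable_component_singleton[OF that] measurable_observation
    by (rule measurable_compose)
  have dm [measurable]: "d k \<in> borel_measurable (L k)" for k
    unfolding d_def[abs_def] L_def
    by (intro borel_measurable_prod_ennreal measurable_compose[OF measurable_component_singleton]
        measurable_latent_density g Sb)
  have Qm [measurable]: "(\<lambda>y. window_integral S p k (v y) A) \<in> borel_measurable (L k)"
    if "A \<in> sets (weak_borel S)" for A k
    using that by (intro measurable_window_integral vm Sb S_finite p_measurable)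

  \<comment> \<open>The probabilistic claims below are instances of this formula for suitable
    \<open>\<Phi>\<close> and \<open>A\<close>.\<close>
  have expect: "(\<integral>\<^sup>+\<omega>. \<Phi> (shifted (W \<omega>)) * indicator A (ground (W \<omega>)) \<partial>M) =
      (\<Sum>k. ck k * (\<integral>\<^sup>+y. d k y * \<Phi> (v y ` {1..k}) * window_integral S p k (v y) A \<partial>L k))"
    if \<Phi>: "\<Phi> \<in> borel_measurable (weak_borel marks)" and A: "A \<in> sets (weak_borel S)" for \<Phi> A
  proof -
    have "(\<lambda>w. \<Phi> (shifted w) * indicator A (ground w)) \<in> borel_measurable (marked_poisson S \<nu>)"
      using measurable_ground[measurable] measurable_shifted[measurable] A[measurable] \<Phi>[measurable]
      by measurable
    from distributed_nn_integral[OF W_density[folded \<nu>_def] this]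
    have "(\<integral>\<^sup>+\<omega>. \<Phi> (shifted (W \<omega>)) * indicator A (ground (W \<omega>)) \<partial>M) =
      (\<integral>\<^sup>+w. ennreal (p (ground w)) * (\<Phi> (shifted w) * indicator A (ground w)) \<partial>marked_poisson S \<nu>)"
      by simp
    then show ?thesis
      using nn_integral_observation[OF S_open S_finite fin_\<nu> sets_\<nu> g em p_measurable A \<Phi>]
      by (simp add: ck_def L_def d_def v_def[abs_def])
  qed

  have inj: "AE y in L k. inj_on (v y) {1..k}" for k
    unfolding L_def v_def by (rule AE_observation_inj)
  have finQ: "AE y in L k. d k y * window_integral S p k (v y) (configs S) \<noteq> \<infinity>" for k
  proof (rule nn_integral_PInf_AE)
    show "(\<lambda>y. d k y * window_integral S p k (v y) (configs S)) \<in> borel_measurable (L k)"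
      using Qm[OF conf] by measurable
    \<comment> \<open>With \<open>\<Phi> = 1\<close> and no restriction on the ground process the
      series is the total mass 1. Its coefficients are positive, so every integral in it is finite
      and each integrand is finite almost everywhere.\<close>
    have "(\<integral>\<^sup>+\<omega>. 1 * indicator (configs S) (ground (W \<omega>)) \<partial>M) = (\<integral>\<^sup>+\<omega>. 1 \<partial>M)"
      using ground_conf by (intro nn_integral_cong) simp
    then have "(\<Sum>k. ck k * (\<integral>\<^sup>+y. d k y * window_integral S p k (v y) (configs S) \<partial>L k)) = 1"
      using expect[of "\<lambda>_. 1", OF _ conf] M.emeasure_space_1 by simp
    then have "ck k * (\<integral>\<^sup>+y. d k y * window_integral S p k (v y) (configs S) \<partial>L k) \<le> 1"
      using sum_le_suminf[OF summableI, of "{k}" "\<lambda>k. ck k * (\<integral>\<^sup>+y. d k y * window_integral S p k (v y) (configs S) \<partial>L k)"]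
      by simp
    then have "ck k * (\<integral>\<^sup>+y. d k y * window_integral S p k (v y) (configs S) \<partial>L k) \<noteq> \<top>"
      by (auto simp: top_unique)
    moreover have "ck k \<noteq> 0" by (simp add: ck_def)
    ultimately show "(\<integral>\<^sup>+y. d k y * window_integral S p k (v y) (configs S) \<partial>L k) \<noteq> \<infinity>"
      by (auto simp: ennreal_mult_eq_top_iff)
  qed

  have N [measurable]: "{u \<in> configs marks. \<not> regular_config S p u} \<in> sets (weak_borel marks)"
  proof -
    have "{u \<in> configs marks. \<not> regular_config S p u}
        = space (weak_borel marks) - {u \<in> configs marks. regular_config S p u}" by auto
    then show ?thesis
      using sets.compl_sets[OF measurable_regular_config[OF Sb S_finite p_measurable]] by (simp only:)
  qed
  have "(\<integral>\<^sup>+\<omega>. indicator {u \<in> configs marks. \<not> regular_config S p u} (shifted (W \<omega>)) *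
      indicator (configs S) (ground (W \<omega>)) \<partial>M) = 0"
  proof -
    let ?N = "{u \<in> configs marks. \<not> regular_config S p u}"
    \<comment> \<open>Nonregular observations have weight zero: atoms outside \<open>S\<close> are
      annihilated by \<open>d\<close>, a vanishing window integral is itself a factor, and up to
      null sets an infinite one occurs only together with \<open>d k y = 0\<close>.\<close>
    have "(\<integral>\<^sup>+y. d k y * indicator ?N (v y ` {1..k}) * window_integral S p k (v y) (configs S) \<partial>L k) = (\<integral>\<^sup>+y. 0 \<partial>L k)" for k
    proof (rule nn_integral_cong_AE)
      show "AE y in L k. d k y * indicator ?N (v y ` {1..k}) * window_integral S p k (v y) (configs S) = 0"
        using inj[of k] finQ[of k]
      proof eventually_elim
        fix y assume y: "inj_on (v y) {1..k}" "d k y * window_integral S p k (v y) (configs S) \<noteq> \<infinity>"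
        show "d k y * indicator ?N (v y ` {1..k}) * window_integral S p k (v y) (configs S) = 0"
        proof (rule ccontr)
          assume *: "\<not> ?thesis"
          then have d: "d k y \<noteq> 0" and q: "window_integral S p k (v y) (configs S) \<noteq> 0"
            and n: "v y ` {1..k} \<in> ?N" by (auto simp: indicator_def split: if_splits)
          have "fst (v y i) \<in> S" if i: "i \<in> {1..k}" "snd (v y i) = 0" for i
          proof -
            have "latent_density c g S (y i) \<noteq> 0" using d i by (auto simp: d_def)
            then show ?thesis
              using i by (auto simp: latent_density_def v_def observation_def indicator_def split: if_splits)
          qed
          then have "\<forall>x\<in>v y ` {1..k}. snd x = 0 \<longrightarrow> fst x \<in> S" by blast
          moreover have "window_integral S p k (v y) (configs S) < \<infinity>"
            using y(2) d by (auto simp: ennreal_mult_eq_top_iff less_top)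
          ultimately have "regular_config S p (v y ` {1..k})"
            using q unfolding regular_config_def config_integral_image[OF Sb S_finite p_measurable conf y(1)]
              zero_less_iff_neq_zero by blast
          then show False using n by simp
        qed
      qed
    qed
    then show ?thesis
      by (subst expect[OF borel_measurable_indicator[OF N] conf]) simp
  qed
  then have "AE \<omega> in M. indicator {u \<in> configs marks. \<not> regular_config S p u} (shifted (W \<omega>)) *
      indicator (configs S) (ground (W \<omega>)) = (0 :: ennreal)"
  proof (subst (asm) nn_integral_0_iff_AE)
    show "(\<lambda>\<omega>. indicator {u \<in> configs marks. \<not> regular_config S p u} (shifted (W \<omega>)) *
      indicator (configs S) (ground (W \<omega>)) :: ennreal) \<in> borel_measurable M"
      using measurable_ground[measurable] measurable_shifted[measurable] WX[measurable] conf[measurable]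
      by measurable
  qed
  then have part1: "AE \<omega> in M. \<exists>m n a l. enumerates S (shifted (W \<omega>)) m n a l \<and>
             0 < c_inv S p m n a l \<and> c_inv S p m n a l < \<infinity>"
  proof (rule AE_mp, intro AE_I2 impI)
    fix \<omega> assume \<omega>: "\<omega> \<in> space M" "indicator {u \<in> configs marks. \<not> regular_config S p u} (shifted (W \<omega>)) *
      indicator (configs S) (ground (W \<omega>)) = (0 :: ennreal)"
    then have "regular_config S p (shifted (W \<omega>))"
      using ground_conf[OF \<omega>(1)] shifted_conf[OF \<omega>(1)] by (simp add: indicator_def split: if_splits)
    then show "\<exists>m n a l. enumerates S (shifted (W \<omega>)) m n a l \<and>
             0 < c_inv S p m n a l \<and> c_inv S p m n a l < \<infinity>"
      by (rule regular_config_enumerates[OF S_open S_finite p_measurable shifted_conf[OF \<omega>(1)]])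
  qed

  have part2: "(\<integral>\<^sup>+\<omega>. indicator F (shifted (W \<omega>)) * posterior_kernel S p (shifted (W \<omega>)) A \<partial>M) =
      (\<integral>\<^sup>+\<omega>. indicator F (shifted (W \<omega>)) * indicator A (ground (W \<omega>)) \<partial>M)"
    if A: "A \<in> sets (weak_borel S)" and F [measurable]: "F \<in> sets (weak_borel marks)" for A F
  proof -
    let ?\<Phi> = "\<lambda>u. indicator F u * posterior_kernel S p u A"
    note [measurable] = measurable_posterior_kernel[OF Sb S_finite p_measurable A]
    \<comment> \<open>The ground process always lies in \<open>configs S\<close>; inserting the
      indicator brings in the denominator of the kernel as a factor.\<close>
    have "(\<integral>\<^sup>+\<omega>. ?\<Phi> (shifted (W \<omega>)) \<partial>M) = (\<integral>\<^sup>+\<omega>. ?\<Phi> (shifted (W \<omega>)) * indicator (configs S) (ground (W \<omega>)) \<partial>M)"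
      using ground_conf by (intro nn_integral_cong) simp
    also have "\<dots> = (\<Sum>k. ck k * (\<integral>\<^sup>+y. d k y * ?\<Phi> (v y ` {1..k}) * window_integral S p k (v y) (configs S) \<partial>L k))"
      by (rule expect[OF _ conf]) measurable
    also have "\<dots> = (\<Sum>k. ck k * (\<integral>\<^sup>+y. d k y * indicator F (v y ` {1..k}) * window_integral S p k (v y) A \<partial>L k))"
    proof (intro suminf_cong arg_cong2[where f = "(*)"] refl nn_integral_cong_AE)
      fix k
      show "AE y in L k. d k y * ?\<Phi> (v y ` {1..k}) * window_integral S p k (v y) (configs S) =
          d k y * indicator F (v y ` {1..k}) * window_integral S p k (v y) A"
        using inj[of k] finQ[of k]
      proof eventually_elim
        fix y assume y: "inj_on (v y) {1..k}" "d k y * window_integral S p k (v y) (configs S) \<noteq> \<infinity>"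
        let ?Q = "window_integral S p k (v y)"
        have "posterior_kernel S p (v y ` {1..k}) A = ?Q A / ?Q (configs S)"
          unfolding posterior_kernel_def
          by (simp only: config_integral_image[OF Sb S_finite p_measurable A y(1)]
              config_integral_image[OF Sb S_finite p_measurable conf y(1)])
        \<comment> \<open>A vanishing denominator forces a vanishing numerator by monotonicity, and
          an infinite one is ruled out by \<open>d k y \<noteq> 0\<close>. If \<open>d k y\<close>
          is 0, both sides of the claim vanish.\<close>
        moreover have "?Q A / ?Q (configs S) * ?Q (configs S) = ?Q A" if "d k y \<noteq> 0"
        proof (cases "?Q (configs S) = 0")
          case True
          have "?Q A \<le> ?Q (configs S)"
            using sets.sets_into_space[OF A] by (intro window_integral_mono) simp
          then show ?thesis using True by simp
        next
          case False
          have "?Q (configs S) \<noteq> \<top>" using y(2) that by (auto simp: ennreal_mult_eq_top_iff)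
          then show ?thesis using False by (simp add: ennreal_divide_times ennreal_divide_self less_top)
        qed
        ultimately show "d k y * ?\<Phi> (v y ` {1..k}) * ?Q (configs S) = d k y * indicator F (v y ` {1..k}) * ?Q A"
          by (cases "d k y = 0") (simp_all add: mult.assoc)
      qed
    qed
    also have "\<dots> = (\<integral>\<^sup>+\<omega>. indicator F (shifted (W \<omega>)) * indicator A (ground (W \<omega>)) \<partial>M)"
      by (rule expect[OF _ A, symmetric]) measurable
    finally show ?thesis .
  qed
  show ?thesis
  proof (intro conjI exI[of _ "posterior_kernel S p"] part1 allI ballI impI)
    show "posterior_kernel S p u A = posterior S p m n a l A"
      if "enumerates S u m n a l \<and> 0 < c_inv S p m n a l \<and> c_inv S p m n a l < \<infinity>" "A \<in> sets (weak_borel S)"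
      for u m n a l A
      using posterior_kernel_eq_posterior[OF S_open S_finite p_measurable that(2)] that(1) by blast
    show "(\<lambda>u. posterior_kernel S p u A) \<in> borel_measurable (weak_borel marks)" if "A \<in> sets (weak_borel S)" for A
      by (rule measurable_posterior_kernel[OF Sb S_finite p_measurable that])
  qed (rule part2)
qed

end
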